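(* There is an algorithm that solves $\textsc{Embed}_{\mathrm{avg}}$-$(K_{\ell+1},n,k)$ in time $(\ell+4)n^2$ for all integers $n\ge\ell\ge 2$ and $k\ge 0$ satisfying $\max\{6\ell^2,\,30k\ell\}\le n$.
   Context: $\mathrm{ex}(n,K_{\ell+1})$ denotes the maximum number of edges in an $n$-vertex graph containing no complete graph $K_{\ell+1}$. The decision problem $\textsc{Embed}_{\mathrm{avg}}$-$(F,n,k)$: given a graph $G$ on $n$ vertices with at least $\mathrm{ex}(n,F)-k$ edges, decide whether $G$ contains a copy of $F$ as a subgraph. *)

theory Defs
  imports Main
begin

section \<open>Graphs, Turan numbers and the problem Embed-avg\<close>

type_synonym 'a graph = "'a set \<times> 'a set set"

abbreviation verts :: "'a graph \<Rightarrow> 'a set" where "verts G \<equiv> fst G"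
abbreviation edges :: "'a graph \<Rightarrow> 'a set set" where "edges G \<equiv> snd G"

definition simple_graph :: "'a graph \<Rightarrow> bool" where
  "simple_graph G \<longleftrightarrow> finite (verts G) \<and>
     (\<forall>e \<in> edges G. \<exists>u v. u \<in> verts G \<and> v \<in> verts G \<and> u \<noteq> v \<and> e = {u, v})"

definition contains_copy :: "'a graph \<Rightarrow> 'b graph \<Rightarrow> bool" where
  "contains_copy G F \<longleftrightarrow> (\<exists>f. inj_on f (verts F) \<and> f ` verts F \<subseteq> verts G \<and>
     (\<forall>e \<in> edges F. f ` e \<in> edges G))"

definition complete_graph :: "nat \<Rightarrow> nat graph" where
  "complete_graph m = ({..<m}, {{u, v} | u v. u < m \<and> v < m \<and> u \<noteq> v})"

text \<open>The maximum is over a nonempty set as soon as \<open>F\<close> has an edge, since the edgeless graph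
  is then \<open>F\<close>-free. Up to isomorphism, \<open>{..<n}\<close> is the vertex set of every n-vertex graph.\<close>

definition ex_number :: "nat \<Rightarrow> 'b graph \<Rightarrow> nat" where
  "ex_number n F = Max {card (edges H) | H :: nat graph.
     simple_graph H \<and> verts H = {..<n} \<and> \<not> contains_copy H F}"

definition embed_avg_instance :: "'b graph \<Rightarrow> nat \<Rightarrow> nat \<Rightarrow> nat graph \<Rightarrow> bool" where
  "embed_avg_instance F n k G \<longleftrightarrow> simple_graph G \<and> verts G = {..<n} \<and>
     int (card (edges G)) \<ge> int (ex_number n F) - int k"


section \<open>Word RAM\<close>

text \<open>The machine has registers and an indirectly addressed memory, both holding words, i.e.
  numbers below a bound \<open>W\<close>. A program is a fixed finite list of instructions; it uses
  only the finitely many registers that it names. Each instruction costs one time unit, also the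
  final \<open>Accept\<close> or \<open>Reject\<close>. A result that does not fit into a word, a division by zero and a
  jump outside of the program make the machine fail.

  In every instruction that computes a value, the first argument is the target register.
  \<open>Load r s\<close> reads the memory cell whose address is in \<open>s\<close> into \<open>r\<close>; \<open>Store r s\<close> writes \<open>r\<close>
  to the memory cell whose address is in \<open>s\<close>. Subtraction is truncated at zero.\<close>

datatype instr =
    Const nat nat
  | Move nat nat
  | Add nat nat nat
  | Sub nat nat nat
  | Mul nat nat nat
  | Div nat nat nat
  | Load nat nat
  | Store nat nat
  | Jump nat
  | JumpLess nat nat nat
  | JumpEq nat nat nat
  | Accept
  | Reject

type_synonym program = "instr list"

datatype state =
    Running (pc: nat) (regs: "nat \<Rightarrow> nat") (mem: "nat \<Rightarrow> nat")
  | Halted bool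
  | Failed

fun set_reg :: "nat \<Rightarrow> nat \<Rightarrow> nat \<Rightarrow> nat \<Rightarrow> (nat \<Rightarrow> nat) \<Rightarrow> (nat \<Rightarrow> nat) \<Rightarrow> state" where
  "set_reg W r x i R M = (if x < W then Running (Suc i) (R(r := x)) M else Failed)"

fun exec_instr :: "nat \<Rightarrow> instr \<Rightarrow> nat \<Rightarrow> (nat \<Rightarrow> nat) \<Rightarrow> (nat \<Rightarrow> nat) \<Rightarrow> state" where
  "exec_instr W (Const r x) i R M = set_reg W r x i R M"
| "exec_instr W (Move r s) i R M = set_reg W r (R s) i R M"
| "exec_instr W (Add r s t) i R M = set_reg W r (R s + R t) i R M"
| "exec_instr W (Sub r s t) i R M = set_reg W r (R s - R t) i R M"
| "exec_instr W (Mul r s t) i R M = set_reg W r (R s * R t) i R M"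
| "exec_instr W (Div r s t) i R M =
     (if R t = 0 then Failed else set_reg W r (R s div R t) i R M)"
| "exec_instr W (Load r s) i R M = set_reg W r (M (R s)) i R M"
| "exec_instr W (Store r s) i R M = Running (Suc i) R (M(R s := R r))"
| "exec_instr W (Jump j) i R M = Running j R M"
| "exec_instr W (JumpLess r s j) i R M = Running (if R r < R s then j else Suc i) R M"
| "exec_instr W (JumpEq r s j) i R M = Running (if R r = R s then j else Suc i) R M"
| "exec_instr W Accept i R M = Halted True"
| "exec_instr W Reject i R M = Halted False"

fun step :: "program \<Rightarrow> nat \<Rightarrow> state \<Rightarrow> state" where
  "step P W (Running i R M) = (if i < length P then exec_instr W (P ! i) i R M else Failed)"
| "step P W (Halted b) = Halted b"
| "step P W Failed = Failed"

text \<open>The input numbers are in the first three registers; the adjacency matrix of the graph on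
  \<open>{..<n}\<close> is in the memory cells \<open>0, \<dots>, n * n - 1\<close>, row by row. Everything else is zero.\<close>

definition init_regs :: "nat \<Rightarrow> nat \<Rightarrow> nat \<Rightarrow> nat \<Rightarrow> nat" where
  "init_regs n l k r = (if r = 0 then n else if r = 1 then l else if r = 2 then k else 0)"

definition adj_matrix :: "nat \<Rightarrow> nat graph \<Rightarrow> nat \<Rightarrow> nat" where
  "adj_matrix n G a = (if a < n * n \<and> {a div n, a mod n} \<in> edges G then 1 else 0)"

definition init_state :: "nat \<Rightarrow> nat \<Rightarrow> nat \<Rightarrow> nat graph \<Rightarrow> state" where
  "init_state n l k G = Running 0 (init_regs n l k) (adj_matrix n G)"

definition answers_within :: "program \<Rightarrow> nat \<Rightarrow> state \<Rightarrow> nat \<Rightarrow> bool \<Rightarrow> bool" where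
  "answers_within P W S T b \<longleftrightarrow> (\<exists>t \<le> T. (step P W ^^ t) S = Halted b)"

text \<open>\<open>P\<close> solves Embed-avg for the clique on \<open>l + 1\<close> vertices, on inputs with the given
  \<open>n\<close>, \<open>l\<close> and \<open>k\<close>, in at most \<open>T\<close> steps. As for any promise problem, nothing is required on
  inputs that are not instances.\<close>

definition solves_clique_embed_avg ::
  "program \<Rightarrow> nat \<Rightarrow> nat \<Rightarrow> nat \<Rightarrow> nat \<Rightarrow> nat \<Rightarrow> bool" where
  "solves_clique_embed_avg P W n l k T \<longleftrightarrow>
     (\<forall>G. embed_avg_instance (complete_graph (l + 1)) n k G \<longrightarrow>
        answers_within P W (init_state n l k G) T (contains_copy G (complete_graph (l + 1))))"

end

theory Submission
  imports Defs
begin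

text \<open>A clique-free instance is complete \<open>l\<close>-partite up to few missing edges. Furedi's argument
  (repeatedly split off the non-neighbours of a vertex of maximum degree) yields an \<open>l\<close>-partition
  such that \<open>e(G)\<close> plus the number of edges inside the parts is at most the number of pairs in
  distinct parts, which is at most the Turan number. So at most \<open>k\<close> edges lie inside parts and at
  most \<open>2 k\<close> crossing pairs are missing. All parts are larger than \<open>4 k\<close>; an edge inside a part would
  extend to a clique by choosing in each other part a vertex without missing pairs. Hence no edge lies
  inside a part, and at most \<open>k\<close> crossing pairs are missing.

  The algorithm recovers this partition. For the first uncoloured vertex \<open>v\<close> it takes \<open>2 k + 1\<close>
  non-neighbours of \<open>v\<close> as a sample and gives a new colour to all vertices with at most \<open>k\<close> neighbours
  in the sample; in the clique-free case this majority vote is exactly the part of \<open>v\<close>. It then checks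
  each pair of vertices once. If all this succeeds, the graph is \<open>l\<close>-colourable; otherwise it
  contains a clique on \<open>l + 1\<close> vertices.\<close>

section \<open>The structure of clique-free instances\<close>

text \<open>Pairs are ordered: for a symmetric relation and \<open>A = B\<close> each unordered pair
  counts twice, so edge inequalities can be stated without halving.\<close>

definition pair_count :: "('a \<Rightarrow> 'a \<Rightarrow> bool) \<Rightarrow> 'a set \<Rightarrow> 'a set \<Rightarrow> nat" where
  "pair_count Q A B = (\<Sum>x\<in>A. \<Sum>y\<in>B. of_bool (Q x y))"

lemma pair_count_Un:
  assumes "finite A" "finite B" "A \<inter> B = {}" and sym: "\<And>x y. Q x y \<longleftrightarrow> Q y x"
  shows "pair_count Q (A \<union> B) (A \<union> B) =
    pair_count Q A A + 2 * pair_count Q B A + pair_count Q B B"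
proof -
  have "pair_count Q A B = pair_count Q B A"
    unfolding pair_count_def by (subst sum.swap) (simp add: sym)
  then show ?thesis
    using assms(1-3) by (simp add: pair_count_def sum.union_disjoint sum.distrib del: sum_of_bool_eq)
qed

lemma pair_count_cong:
  assumes "\<And>x y. x \<in> A \<Longrightarrow> y \<in> B \<Longrightarrow> Q x y \<longleftrightarrow> Q' x y"
  shows "pair_count Q A B = pair_count Q' A B"
  using assms by (simp add: pair_count_def)

lemma sum_of_bool_card:
  assumes "finite B"
  shows "(\<Sum>y\<in>B. of_bool (P y)) = card {y \<in> B. P y}"
  using assms by (simp add: Int_def)

lemma pair_count_card:
  assumes "finite A" "finite B"
  shows "pair_count Q A B = card {(x, y). x \<in> A \<and> y \<in> B \<and> Q x y}"
proof -
  have "{(x, y). x \<in> A \<and> y \<in> B \<and> Q x y} = (SIGMA x:A. {y \<in> B. Q x y})"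
    by auto
  then show ?thesis
    using assms by (simp add: pair_count_def sum_of_bool_card del: sum_of_bool_eq)
qed

text \<open>Induction on \<open>l\<close>. The neighbourhood \<open>U'\<close> of a vertex
  \<open>v\<close> of maximum degree has cliques smaller by one, since \<open>v\<close> extends
  them. The induction hypothesis colours \<open>U'\<close>, and the rest \<open>A\<close> becomes
  one further class. Passing from \<open>U'\<close> to \<open>U\<close> adds
  \<open>2 * card A * card U'\<close> on the right and twice the degree sum over \<open>A\<close> on
  the left.\<close>

lemma furedi_partition:
  fixes r :: "'a \<Rightarrow> 'a \<Rightarrow> bool"
  assumes sym: "\<And>x y. r x y \<longleftrightarrow> r y x" and irr: "\<And>x. \<not> r x x"
    and "finite U"
    and "\<nexists>X. X \<subseteq> U \<and> card X = Suc l \<and> (\<forall>x\<in>X. \<forall>y\<in>X. x \<noteq> y \<longrightarrow> r x y)"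
  shows "\<exists>c :: 'a \<Rightarrow> nat. c ` U \<subseteq> {..<l} \<and>
    pair_count r U U + pair_count (\<lambda>x y. r x y \<and> c x = c y) U U
      \<le> pair_count (\<lambda>x y. c x \<noteq> c y) U U"
  using assms(3,4)
proof (induction l arbitrary: U)
  case 0
  have "U = {}"
  proof (rule ccontr)
    assume "U \<noteq> {}"
    then obtain x where "x \<in> U" by auto
    then show False
      using "0.prems"(2)[unfolded not_ex, rule_format, of "{x}"] by auto
  qed
  then show ?case by (simp add: pair_count_def)
next
  case (Suc l)
  show ?case
  proof (cases "U = {}")
    case True
    then show ?thesis by (simp add: pair_count_def)
  next
    case False
    define d where "d x = card {y \<in> U. r x y}" for x
    obtain v where v: "v \<in> U" and vmax: "\<And>x. x \<in> U \<Longrightarrow> d x \<le> d v"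
    proof -
      have "Max (d ` U) \<in> d ` U" using False Suc.prems(1) by (intro Max_in) auto
      then obtain v where "v \<in> U" "d v = Max (d ` U)" by auto
      then show ?thesis using Suc.prems(1) that[of v] by simp
    qed
    define U' where "U' = {y \<in> U. r v y}"
    define A where "A = U - U'"
    have fin: "finite U'" "finite A" "A \<inter> U' = {}" "U' \<inter> A = {}" and U: "U = U' \<union> A"
      using Suc.prems(1) by (auto simp: U'_def A_def)
    have "\<nexists>X. X \<subseteq> U' \<and> card X = Suc l \<and> (\<forall>x\<in>X. \<forall>y\<in>X. x \<noteq> y \<longrightarrow> r x y)"
    proof
      assume "\<exists>X. X \<subseteq> U' \<and> card X = Suc l \<and> (\<forall>x\<in>X. \<forall>y\<in>X. x \<noteq> y \<longrightarrow> r x y)"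
      then obtain X where X: "X \<subseteq> U'" "card X = Suc l" "\<forall>x\<in>X. \<forall>y\<in>X. x \<noteq> y \<longrightarrow> r x y"
        by auto
      have "finite X" "v \<notin> X" using X(1) fin irr by (auto intro: finite_subset simp: U'_def)
      then have "insert v X \<subseteq> U \<and> card (insert v X) = Suc (Suc l) \<and>
          (\<forall>x\<in>insert v X. \<forall>y\<in>insert v X. x \<noteq> y \<longrightarrow> r x y)"
        using X v sym by (auto simp: U'_def)
      then show False using Suc.prems(2) by blast
    qed
    from Suc.IH[OF fin(1) this] obtain c :: "'a \<Rightarrow> nat" where c: "c ` U' \<subseteq> {..<l}"
      and le: "pair_count r U' U' + pair_count (\<lambda>x y. r x y \<and> c x = c y) U' U'
        \<le> pair_count (\<lambda>x y. c x \<noteq> c y) U' U'"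
      by auto
    define c' where "c' x = (if x \<in> U' then c x else l)" for x
    have ran: "c' ` U \<subseteq> {..<Suc l}"
      using c by (auto simp: c'_def less_Suc_eq)
    have A': "x \<in> A \<Longrightarrow> c' x = l" "x \<in> U' \<Longrightarrow> c' x = c x \<and> c x < l" for x
      using c by (auto simp: c'_def A_def)
    \<comment> \<open>This is the degree sum over \<open>A\<close>: each of the
      \<open>card A\<close> degrees is at most \<open>d v\<close>, which is \<open>card U'\<close>.
      It counts edges inside \<open>A\<close> twice, which is what pays for them as monochromatic
      edges.\<close>
    have deg: "pair_count r A U' + pair_count r A A \<le> card A * card U'"
    proof -
      have "pair_count r A U' + pair_count r A A = (\<Sum>x\<in>A. d x)"
        unfolding d_def U pair_count_def sum_of_bool_card[OF fin(1)] sum_of_bool_card[OF fin(2)]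
          sum.distrib[symmetric]
        using fin by (intro sum.cong[OF refl], subst card_Un_disjoint[symmetric])
          (auto intro!: arg_cong[where f = card])
      also have "\<dots> \<le> (\<Sum>x\<in>A. d v)"
        by (intro sum_mono vmax) (auto simp: A_def)
      finally show ?thesis by (simp add: d_def U'_def)
    qed
    have 1: "pair_count (\<lambda>x y. r x y \<and> c' x = c' y) U' U'
        = pair_count (\<lambda>x y. r x y \<and> c x = c y) U' U'"
      by (rule pair_count_cong) (use A' in auto)
    have 2: "pair_count (\<lambda>x y. r x y \<and> c' x = c' y) A U' = 0"
      unfolding pair_count_def using A' by (intro sum.neutral ballI) fastforce
    have 3: "pair_count (\<lambda>x y. r x y \<and> c' x = c' y) A A = pair_count r A A"
      by (rule pair_count_cong) (use A' in auto)
    have 4: "pair_count (\<lambda>x y. c' x \<noteq> c' y) U' U' = pair_count (\<lambda>x y. c x \<noteq> c y) U' U'"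
      by (rule pair_count_cong) (use A' in auto)
    have 5: "pair_count (\<lambda>x y. c' x \<noteq> c' y) A U' = card A * card U'"
    proof -
      have "pair_count (\<lambda>x y. c' x \<noteq> c' y) A U' = pair_count (\<lambda>x y. True) A U'"
        by (rule pair_count_cong) (use A' in fastforce)
      then show ?thesis by (simp add: pair_count_def)
    qed
    have "pair_count r U U + pair_count (\<lambda>x y. r x y \<and> c' x = c' y) U U
        \<le> pair_count (\<lambda>x y. c' x \<noteq> c' y) U U"
    proof -
      have a: "pair_count r U U = pair_count r U' U' + 2 * pair_count r A U' + pair_count r A A"
        unfolding U using fin sym by (intro pair_count_Un) auto
      have b: "pair_count (\<lambda>x y. r x y \<and> c' x = c' y) U U
          = pair_count (\<lambda>x y. r x y \<and> c' x = c' y) U' U'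
            + 2 * pair_count (\<lambda>x y. r x y \<and> c' x = c' y) A U'
            + pair_count (\<lambda>x y. r x y \<and> c' x = c' y) A A"
        unfolding U using fin sym by (intro pair_count_Un) auto
      have c: "pair_count (\<lambda>x y. c' x \<noteq> c' y) U U
          = pair_count (\<lambda>x y. c' x \<noteq> c' y) U' U' + 2 * pair_count (\<lambda>x y. c' x \<noteq> c' y) A U'
            + pair_count (\<lambda>x y. c' x \<noteq> c' y) A A"
        unfolding U using fin by (intro pair_count_Un) auto
      show ?thesis
        unfolding a b c 1 2 3 4 5 using le deg by linarith
    qed
    with ran show ?thesis by blast
  qed
qed

lemma pair_count_edges:
  assumes "finite V" and E: "\<And>e. e \<in> E \<Longrightarrow> \<exists>u v. u \<in> V \<and> v \<in> V \<and> u \<noteq> v \<and> e = {u, v}"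
  shows "pair_count (\<lambda>x y. {x, y} \<in> E) V V = 2 * card E"
proof -
  have "E \<subseteq> Pow V" using E by blast
  then have finE: "finite E" using assms(1) by (meson finite_Pow_iff finite_subset)
  have "{(x, y). x \<in> V \<and> y \<in> V \<and> {x, y} \<in> E} = (\<Union>e\<in>E. {(x, y). {x, y} = e})"
    using E by (fastforce simp: doubleton_eq_iff)
  moreover have two: "finite {(x, y). {x, y} = e} \<and> card {(x, y). {x, y} = e} = 2" if e: "e \<in> E" for e
  proof -
    obtain u v where uv: "u \<noteq> v" "e = {u, v}" using E[OF e] by auto
    have "{(x, y). {x, y} = e} = {(u, v), (v, u)}"
      unfolding uv by (auto simp: doubleton_eq_iff)
    then show ?thesis using uv by auto
  qed
  moreover have "card (\<Union>e\<in>E. {(x, y). {x, y} = e}) = (\<Sum>e\<in>E. card {(x, y). {x, y} = e})"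
    using finE two by (intro card_UN_disjoint) auto
  ultimately show ?thesis
    using assms(1) by (simp add: pair_count_card)
qed

section \<open>Colourings, cliques and the extremal number\<close>

text \<open>Pigeonhole. It serves both the lower bound on \<open>ex_number\<close> by multipartite
  graphs and, later, the soundness of \<open>Reject\<close>.\<close>

lemma coloring_imp_no_clique:
  fixes C :: "'a \<Rightarrow> 'c"
  assumes "finite Y" "card Y \<le> l" "C ` verts G \<subseteq> Y"
    and proper: "\<And>u v. u \<in> verts G \<Longrightarrow> v \<in> verts G \<Longrightarrow> {u, v} \<in> edges G \<Longrightarrow> C u \<noteq> C v"
  shows "\<not> contains_copy G (complete_graph (l + 1))"
proof
  assume "contains_copy G (complete_graph (l + 1))"
  then obtain f where f: "f ` {..<l + 1} \<subseteq> verts G"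
    and fe: "\<forall>e\<in>{{u, v} |u v. u < l + 1 \<and> v < l + 1 \<and> u \<noteq> v}. f ` e \<in> edges G"
    by (auto simp: contains_copy_def complete_graph_def)
  have "(C \<circ> f) ` {..<l + 1} \<subseteq> C ` verts G"
    using f by (simp only: image_comp[symmetric] image_mono)
  then have "card ((C \<circ> f) ` {..<l + 1}) \<le> card Y"
    using assms(1,3) by (intro card_mono) auto
  then have "\<not> inj_on (C \<circ> f) {..<l + 1}"
    using assms(2) by (intro pigeonhole) simp
  then obtain i j where ij: "i < l + 1" "j < l + 1" "i \<noteq> j" "C (f i) = C (f j)"
    by (auto simp: inj_on_def)
  then have "f ` {i, j} \<in> edges G" using fe by blast
  then show False using proper[of "f i" "f j"] ij f by auto
qed

lemma clique_imp_copy: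
  assumes "X \<subseteq> verts G" "card X = Suc l"
    and "\<And>x y. x \<in> X \<Longrightarrow> y \<in> X \<Longrightarrow> x \<noteq> y \<Longrightarrow> {x, y} \<in> edges G"
  shows "contains_copy G (complete_graph (l + 1))"
proof -
  have "finite X" using assms(2) by (metis card.infinite nat.distinct(1))
  then obtain f where f: "bij_betw f {0..<Suc l} X"
    using ex_bij_betw_nat_finite[of X] assms(2) by metis
  then have im: "f ` {..<l + 1} = X" and inj: "inj_on f {..<l + 1}"
    by (auto simp: bij_betw_def atLeast0LessThan)
  show ?thesis
    unfolding contains_copy_def complete_graph_def
  proof (intro exI[of _ f] conjI)
    show "\<forall>e\<in>edges ({..<l + 1}, {{u, v} |u v. u < l + 1 \<and> v < l + 1 \<and> u \<noteq> v}). f ` e \<in> edges G"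
    proof
      fix e assume "e \<in> edges ({..<l + 1}, {{u, v} |u v. u < l + 1 \<and> v < l + 1 \<and> u \<noteq> v})"
      then obtain u v where e: "e = {u, v}" "u < l + 1" "v < l + 1" "u \<noteq> v" by auto
      then have "f u \<in> X" "f v \<in> X" "f u \<noteq> f v"
        using im inj by (auto simp: inj_on_def)
      then show "f ` e \<in> edges G" using assms(3) e by simp
    qed
  qed (use im inj assms(1) in auto)
qed

definition multipartite :: "nat \<Rightarrow> (nat \<Rightarrow> nat) \<Rightarrow> nat graph" where
  "multipartite n c = ({..<n}, {{u, v} | u v. u < n \<and> v < n \<and> c u \<noteq> c v})"

lemma multipartite_edge_iff:
  "{u, v} \<in> edges (multipartite n c) \<longleftrightarrow> u < n \<and> v < n \<and> c u \<noteq> c v"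
  by (auto simp: multipartite_def doubleton_eq_iff)

lemma finite_multipartite_edges: "finite (edges (multipartite n c))"
  by (rule finite_subset[of _ "Pow {..<n}"]) (auto simp: multipartite_def)

lemma pair_count_multipartite:
  "pair_count (\<lambda>x y. c x \<noteq> c y) {..<n} {..<n} = 2 * card (edges (multipartite n c))"
proof -
  have "pair_count (\<lambda>x y. c x \<noteq> c y) {..<n} {..<n}
      = pair_count (\<lambda>x y. {x, y} \<in> edges (multipartite n c)) {..<n} {..<n}"
    by (rule pair_count_cong) (simp add: multipartite_edge_iff)
  also have "\<dots> = 2 * card (edges (multipartite n c))"
    by (rule pair_count_edges) (auto simp: multipartite_def)
  finally show ?thesis .
qed

text \<open>The Turan graph never has to be identified: beyond the edge bound of an instance, all
  that is used of \<open>ex_number\<close> is that it dominates every complete multipartite graph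
  with at most \<open>l\<close> parts.\<close>

lemma multipartite_le_ex:
  assumes "c ` {..<n} \<subseteq> {..<l}"
  shows "card (edges (multipartite n c)) \<le> ex_number n (complete_graph (l + 1))"
  unfolding ex_number_def
proof (rule Max_ge)
  let ?S = "{H :: nat graph. simple_graph H \<and> verts H = {..<n}}"
  have "?S \<subseteq> {{..<n}} \<times> Pow (Pow {..<n})"
    by (fastforce simp: simple_graph_def)
  then have "finite ?S" by (rule finite_subset) simp
  then have "finite ((\<lambda>H. card (edges H)) ` ?S)" by simp
  then show "finite {card (edges H) |H. simple_graph H \<and> verts H = {..<n} \<and>
      \<not> contains_copy H (complete_graph (l + 1))}"
    by (rule rev_finite_subset) blast
next
  have "simple_graph (multipartite n c)"
    by (auto simp: simple_graph_def multipartite_def)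
  moreover have "\<not> contains_copy (multipartite n c) (complete_graph (l + 1))"
  proof (rule coloring_imp_no_clique[where C = c and Y = "{..<l}"])
    show "c ` verts (multipartite n c) \<subseteq> {..<l}"
      using assms by (simp add: multipartite_def)
  qed (auto simp: multipartite_edge_iff)
  ultimately show "card (edges (multipartite n c)) \<in> {card (edges H) |H. simple_graph H \<and>
      verts H = {..<n} \<and> \<not> contains_copy H (complete_graph (l + 1))}"
    by (auto simp: multipartite_def)
qed

text \<open>Moving a single vertex from the largest part into a small one would create a complete
  multipartite graph with more than the extremal number of edges.\<close>

lemma large_parts:
  assumes c: "c ` {..<n} \<subseteq> {..<l}" and "i < l" and n: "12 * l \<le> n" "30 * k * l \<le> n"
    and ge: "ex_number n (complete_graph (l + 1)) \<le> card (edges (multipartite n c)) + k"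
  shows "4 * k + 2 \<le> card {u. u < n \<and> c u = i}"
proof (rule ccontr)
  assume small: "\<not> ?thesis"
  define V where "V j = {u. u < n \<and> c u = j}" for j
  have finV: "finite (V j)" for j by (simp add: V_def)
  \<comment> \<open>Averaging: some part has at least \<open>n / l\<close> vertices, hence at least
    \<open>max 12 (30 * k)\<close> by the bounds on \<open>n\<close>.\<close>
  have "\<exists>j<l. n \<le> l * card (V j)"
  proof (rule ccontr)
    assume "\<not> ?thesis"
    then have "\<And>j. j < l \<Longrightarrow> l * card (V j) < n" by (meson not_le)
    then have "(\<Sum>j<l. l * card (V j)) < (\<Sum>j<l. n)"
      using \<open>i < l\<close> by (intro sum_strict_mono) auto
    moreover have "(\<Sum>j<l. card (V j)) = n"
    proof -
      have "(\<Union>j<l. V j) = {..<n}" using c by (auto simp: V_def)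
      moreover have "card (\<Union>j<l. V j) = (\<Sum>j<l. card (V j))"
        by (intro card_UN_disjoint) (auto simp: V_def)
      ultimately show ?thesis by simp
    qed
    ultimately show False by (simp flip: sum_distrib_left)
  qed
  then obtain j where j: "j < l" "n \<le> l * card (V j)" by auto
  have "l * 12 \<le> l * card (V j)" "l * (30 * k) \<le> l * card (V j)"
    using order_trans[OF n(1) j(2)] order_trans[OF n(2) j(2)] by (simp_all add: ac_simps)
  then have big: "12 \<le> card (V j)" "30 * k \<le> card (V j)"
    using \<open>i < l\<close> by simp_all
  have "i \<noteq> j" using small big by (auto simp: V_def)
  obtain w where w: "w \<in> V j" using big(1) finV[of j] by fastforce
  define c' where "c' = c(w := i)"
  let ?E = "edges (multipartite n c)" and ?E' = "edges (multipartite n c')"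
  have wn: "w < n" "c w = j" using w by (auto simp: V_def)
  \<comment> \<open>Recolouring \<open>w\<close> from \<open>j\<close> to \<open>i\<close> destroys
    only the pairs between \<open>w\<close> and \<open>V i\<close>; it creates those between
    \<open>w\<close> and the rest of \<open>V j\<close>.\<close>
  have sub: "?E' \<supseteq> ?E - (\<lambda>x. {w, x}) ` V i"
  proof
    fix e assume "e \<in> ?E - (\<lambda>x. {w, x}) ` V i"
    then obtain x y where xy: "e = {x, y}" "x < n" "y < n" "c x \<noteq> c y" "e \<notin> (\<lambda>x. {w, x}) ` V i"
      by (auto simp: multipartite_def)
    have "c' x \<noteq> c' y"
      using xy by (auto simp: c'_def V_def insert_commute)
    then show "e \<in> ?E'" using xy by (simp add: multipartite_edge_iff)
  qed
  have new: "(\<lambda>x. {w, x}) ` (V j - {w}) \<subseteq> ?E'"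
    using wn \<open>i \<noteq> j\<close> by (auto simp: multipartite_edge_iff c'_def V_def split: if_splits)
  have disj: "(?E - (\<lambda>x. {w, x}) ` V i) \<inter> (\<lambda>x. {w, x}) ` (V j - {w}) = {}"
    using wn by (auto simp: multipartite_edge_iff V_def)
  have inj: "inj_on (\<lambda>x. {w, x}) B" for B
    by (auto simp: inj_on_def doubleton_eq_iff)
  have "card ?E - card (V i) \<le> card (?E - (\<lambda>x. {w, x}) ` V i)"
    using diff_card_le_card_Diff[of "(\<lambda>x. {w, x}) ` V i" ?E] finV
    by (simp add: card_image[OF inj])
  moreover have "card ((\<lambda>x. {w, x}) ` (V j - {w})) = card (V j) - 1"
    using w finV by (simp add: card_image[OF inj])
  moreover have "card ((?E - (\<lambda>x. {w, x}) ` V i) \<union> (\<lambda>x. {w, x}) ` (V j - {w})) \<le> card ?E'"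
    using sub new finite_multipartite_edges by (intro card_mono) auto
  ultimately have "card ?E - card (V i) + (card (V j) - 1) \<le> card ?E'"
    using disj finV finite_multipartite_edges by (simp add: card_Un_disjoint)
  moreover have "card ?E' \<le> ex_number n (complete_graph (l + 1))"
    using c \<open>i < l\<close> by (intro multipartite_le_ex) (auto simp: c'_def)
  \<comment> \<open>The loss is at most \<open>4 * k + 1\<close> and the total can grow by at most
    \<open>k\<close>, so \<open>card (V j)\<close> would be at most \<open>5 * k + 2\<close>. This
    contradicts 12 for \<open>k = 0\<close> and \<open>30 * k\<close> otherwise.\<close>
  ultimately show False
    using ge small big unfolding V_def[symmetric] by linarith
qed

section \<open>Clique-free instances are almost complete multipartite\<close>

text \<open>The size bound leaves \<open>2 * k + 1\<close> further vertices in the part of any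
  \<open>v\<close>: enough for a sample whose majority survives \<open>k\<close> wrong
  votes.\<close>

definition almost_complete_partition :: "nat \<Rightarrow> nat \<Rightarrow> nat \<Rightarrow> nat graph \<Rightarrow> (nat \<Rightarrow> nat) \<Rightarrow> bool" where
  "almost_complete_partition n l k G c \<longleftrightarrow> c ` {..<n} \<subseteq> {..<l} \<and>
     edges G \<subseteq> edges (multipartite n c) \<and> card (edges (multipartite n c) - edges G) \<le> k \<and>
     (\<forall>v<n. 2 * k + 2 \<le> card {u. u < n \<and> c u = c v})"

theorem clique_free_imp_partition:
  assumes inst: "embed_avg_instance (complete_graph (l + 1)) n k G"
    and free: "\<not> contains_copy G (complete_graph (l + 1))"
    and n: "12 * l \<le> n" "30 * k * l \<le> n"
  shows "\<exists>c. almost_complete_partition n l k G c"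
proof -
  let ?ex = "ex_number n (complete_graph (l + 1))"
  define r where "r x y \<longleftrightarrow> {x, y} \<in> edges G" for x y
  have simple: "simple_graph G" and V: "verts G = {..<n}" and m: "?ex \<le> card (edges G) + k"
    using inst by (auto simp: embed_avg_instance_def)
  have E: "\<exists>u v. u \<in> {..<n} \<and> v \<in> {..<n} \<and> u \<noteq> v \<and> e = {u, v}" if "e \<in> edges G" for e
    using simple that V by (auto simp: simple_graph_def)
  have "edges G \<subseteq> Pow {..<n}" using E by blast
  then have finE: "finite (edges G)" by (rule finite_subset) simp
  have sym: "r x y \<longleftrightarrow> r y x" for x y by (simp add: r_def insert_commute)
  have irr: "\<not> r x x" for x using E[of "{x, x}"] by (auto simp: r_def)
  have noclq: "\<nexists>X. X \<subseteq> {..<n} \<and> card X = Suc l \<and> (\<forall>x\<in>X. \<forall>y\<in>X. x \<noteq> y \<longrightarrow> r x y)"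
    using free clique_imp_copy[of _ G l] V unfolding r_def by metis
  obtain c :: "nat \<Rightarrow> nat" where c: "c ` {..<n} \<subseteq> {..<l}"
    and fur: "pair_count r {..<n} {..<n} + pair_count (\<lambda>x y. r x y \<and> c x = c y) {..<n} {..<n}
      \<le> pair_count (\<lambda>x y. c x \<noteq> c y) {..<n} {..<n}"
    using furedi_partition[OF sym irr finite_lessThan noclq] by blast
  let ?M = "edges (multipartite n c)"
  let ?in = "{e \<in> edges G. e \<notin> ?M}"
  have "pair_count r {..<n} {..<n} = 2 * card (edges G)"
    unfolding r_def using E by (intro pair_count_edges) auto
  moreover have "pair_count (\<lambda>x y. r x y \<and> c x = c y) {..<n} {..<n} = 2 * card ?in"
  proof -
    have "pair_count (\<lambda>x y. r x y \<and> c x = c y) {..<n} {..<n}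
        = pair_count (\<lambda>x y. {x, y} \<in> ?in) {..<n} {..<n}"
      by (rule pair_count_cong) (auto simp: r_def multipartite_edge_iff)
    then show ?thesis using E by (subst (asm) pair_count_edges) auto
  qed
  ultimately have tot: "card (edges G) + card ?in \<le> card ?M"
    using fur by (simp add: pair_count_multipartite)
  have Mex: "card ?M \<le> ?ex" using c by (rule multipartite_le_ex)
  have big: "4 * k + 2 \<le> card {u. u < n \<and> c u = i}" if "i < l" for i
    using large_parts[OF c that n] m tot by linarith
  \<comment> \<open>By \<open>tot\<close>, \<open>Mex\<close> and \<open>m\<close>, at most
    \<open>k\<close> edges lie inside parts. Hence at least \<open>card (edges G) - k\<close> edges
    cross, and the number of crossing pairs exceeds \<open>card (edges G)\<close> by at most
    \<open>k\<close>.\<close>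
  have mis: "card (?M - edges G) \<le> 2 * k"
  proof -
    have "card (edges G) = card (?in \<union> (?M \<inter> edges G))"
      by (rule arg_cong[where f = card]) auto
    moreover have "card (?in \<union> (?M \<inter> edges G)) = card ?in + card (?M \<inter> edges G)"
      using finE by (intro card_Un_disjoint) auto
    moreover have "card ?M = card (?M \<inter> edges G) + card (?M - edges G)"
      using finite_multipartite_edges[of n c]
      by (subst card_Un_disjoint[symmetric]) (auto intro!: arg_cong[where f = card])
    ultimately show ?thesis using tot Mex m by linarith
  qed
  \<comment> \<open>Otherwise each \<open>w\<close> in part \<open>i\<close> has a missing pair
    \<open>{w, f w}\<close>. As \<open>f w\<close> lies outside the part, the pair determines
    \<open>w\<close>, giving at least \<open>4 * k + 2\<close> missing pairs where only
    \<open>2 * k\<close> exist.\<close>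
  have full: "\<exists>w. w < n \<and> c w = i \<and> (\<forall>x<n. c x \<noteq> i \<longrightarrow> r w x)" if "i < l" for i
  proof (rule ccontr)
    assume "\<not> ?thesis"
    then have "\<forall>w. \<exists>x. w < n \<and> c w = i \<longrightarrow> x < n \<and> c x \<noteq> i \<and> \<not> r w x" by auto
    then obtain f where f: "\<And>w. w < n \<Longrightarrow> c w = i \<Longrightarrow> f w < n \<and> c (f w) \<noteq> i \<and> \<not> r w (f w)"
      by metis
    have "card {u. u < n \<and> c u = i} \<le> card (?M - edges G)"
    proof (rule card_inj_on_le[where f = "\<lambda>w. {w, f w}"])
      show "inj_on (\<lambda>w. {w, f w}) {u. u < n \<and> c u = i}"
        using f by (force simp: inj_on_def doubleton_eq_iff)
      show "(\<lambda>w. {w, f w}) ` {u. u < n \<and> c u = i} \<subseteq> ?M - edges G"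
        using f by (fastforce simp: multipartite_edge_iff r_def)
    qed (simp add: finite_multipartite_edges)
    then show False using big[OF that] mis by linarith
  qed
  \<comment> \<open>An edge inside a part, together with one fully joined vertex from each of the
    other \<open>l - 1\<close> parts, is a clique on \<open>l + 1\<close> vertices.\<close>
  have indep: "edges G \<subseteq> ?M"
  proof (rule subsetI, rule ccontr)
    fix e assume e: "e \<in> edges G" "e \<notin> ?M"
    obtain u v where uv: "e = {u, v}" "u < n" "v < n" "u \<noteq> v" using E[OF e(1)] by auto
    have same: "c u = c v" using e uv by (simp add: multipartite_edge_iff)
    have "c u < l" using c uv by auto
    obtain w where w: "\<And>i. i < l \<Longrightarrow> w i < n \<and> c (w i) = i \<and> (\<forall>x<n. c x \<noteq> i \<longrightarrow> r (w i) x)"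
      using full by metis
    define I where "I = {..<l} - {c u}"
    let ?X = "insert u (insert v (w ` I))"
    have inj: "inj_on w I" using w by (metis DiffD1 I_def inj_on_def lessThan_iff)
    have nin: "v \<notin> w ` I" "u \<notin> w ` I" using w same by (auto simp: I_def)
    have "finite I" "card I = l - 1" using \<open>c u < l\<close> by (auto simp: I_def)
    then have "card ?X = Suc l"
      using nin uv(4) \<open>c u < l\<close> by (simp add: card_image[OF inj])
    moreover have "?X \<subseteq> {..<n}" using w uv by (auto simp: I_def)
    moreover have "\<forall>x\<in>?X. \<forall>y\<in>?X. x \<noteq> y \<longrightarrow> r x y"
    proof -
      have a: "r (w i) (w j)" if "i \<in> I" "j \<in> I" "w i \<noteq> w j" for i j
        using w[of i] w[of j] that by (auto simp: I_def)
      have b: "r (w i) u" "r (w i) v" "r u (w i)" "r v (w i)" if "i \<in> I" for i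
        using w[of i] that uv same sym by (auto simp: I_def)
      have "r u v" "r v u" using e uv sym by (auto simp: r_def)
      then show ?thesis using a b by auto
    qed
    ultimately show False using noclq by blast
  qed
  \<comment> \<open>With no edge inside a part, the missing pairs number exactly the difference of
    the edge counts, which improves \<open>2 * k\<close> to \<open>k\<close>.\<close>
  have "card (?M - edges G) \<le> k"
    using card_Diff_subset[OF finE indep] Mex m by linarith
  moreover have "2 * k + 2 \<le> card {u. u < n \<and> c u = c v}" if "v < n" for v
    using big[of "c v"] c that by fastforce
  ultimately show ?thesis
    using c indep unfolding almost_complete_partition_def by blast
qed

section \<open>The program\<close>

text \<open>Register \<open>3\<close> holds \<open>1\<close>, register \<open>17\<close> is never written and holds \<open>0\<close>. Registers \<open>4\<close>, \<open>5\<close>, \<open>6\<close> hold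
  the address \<open>n * n\<close> of the colour array (\<open>0\<close> means uncoloured), the address of the sample that follows
  it, and the end of the sample. Register \<open>7\<close> is the last colour used, \<open>8\<close> the current vertex \<open>v\<close>, and
  \<open>9\<close> the start of its row. A sample element \<open>w\<close> is stored as its row start \<open>w * n\<close>.

  Address \<open>6\<close> starts the loop over \<open>v\<close>, \<open>15\<close> the search for the sample, \<open>25\<close> the loop over the
  vertices \<open>u\<close> to be recoloured, \<open>27\<close> the loop over the sample, \<open>38\<close> goes on to the next \<open>v\<close>. Addresses
  \<open>43\<close> and \<open>48\<close> start the outer and inner loop of the final check over pairs of vertices.\<close>

definition clique_program :: program where
  "clique_program =
   [Const 3 1, Mul 4 0 0, Add 5 4 0, Add 6 2 2, Add 6 6 3, Add 6 6 5,
    Add 11 4 8, Load 10 11, JumpLess 17 10 38, JumpEq 7 1 59, Add 7 7 3, Store 7 11,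
    Move 14 5, Add 12 9 8, Add 13 9 0,
    Add 12 12 3, JumpEq 12 13 59, Load 10 12, JumpEq 10 3 15, Sub 10 12 9, Mul 10 10 0,
    Store 10 14, Add 14 14 3, JumpLess 14 6 15, Const 15 0,
    Const 16 0, Move 14 5,
    Load 10 14, Add 10 10 15, Load 10 10, Add 16 16 10, Add 14 14 3, JumpLess 14 6 27,
    JumpLess 2 16 36, Add 11 4 15, Store 7 11, Add 15 15 3, JumpLess 15 0 25,
    Add 8 8 3, Add 9 9 0, JumpLess 8 0 6,
    Const 15 1, Move 9 0,
    Add 11 4 15, Load 16 11, Move 12 9, Add 13 9 15, Move 14 4,
    Load 10 12, JumpEq 10 17 52, Load 10 14, JumpEq 10 16 59,
    Add 12 12 3, Add 14 14 3, JumpLess 12 13 48,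
    Add 15 15 3, Add 9 9 0, JumpLess 15 0 43, Reject, Accept]"

section \<open>Symbolic execution of the program, block by block\<close>

text \<open>Reads beyond the list give 0. Configurations list registers 0 to 16, so this default
  supplies the constant zero in register 17.\<close>

definition register_file :: "nat list \<Rightarrow> nat \<Rightarrow> nat" where
  "register_file xs i = (if i < length xs then xs ! i else 0)"

lemma register_file_update: "i < length xs \<Longrightarrow> (register_file xs)(i := y) = register_file (xs[i := y])"
  by (auto simp: register_file_def)

text \<open>Peels off the first step rather than the last, so that simplification executes a block
  in program order.\<close>

lemma funpow_step_numeral:
  "(f ^^ numeral m) x = (f ^^ pred_numeral m) (f x)"
  "(f ^^ Suc i) x = (f ^^ i) (f x)"
  by (simp_all add: numeral_eq_Suc funpow_swap1)

lemma init_regs_register_file: "init_regs n l k = register_file [n,l,k,0,0,0,0,0,0,0,0,0,0,0,0,0,0]"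
  by (rule ext) (auto simp: init_regs_def register_file_def nth_Cons split: nat.split)

lemmas exec = clique_program_def register_file_update funpow_step_numeral

abbreviation conf :: "nat \<Rightarrow> nat list \<Rightarrow> (nat \<Rightarrow> nat) \<Rightarrow> state" where
  "conf i xs M \<equiv> Running i (register_file xs) M"

text \<open>From here to \<open>run55_last\<close>, each lemma follows one path through a block. The
  exponent is its exact length; the assumptions are branch conditions, memory contents and word
  bounds.\<close>

lemma run_init:
  assumes "n * n + n + 2 * k + 1 < W"
  shows "(step clique_program W ^^ 6) (conf 0 [n,l,k,0,0,0,0,0,0,0,0,0,0,0,0,0,0] M) =
    conf 6 [n,l,k,1,n*n,n*n+n,n*n+n+(2*k+1),0,0,0,0,0,0,0,0,0,0] M"
  using assms by (simp add: exec register_file_def mult_2 add.commute add.left_commute)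

lemma run6_coloured:
  assumes "nn + v < W" and "0 < M (nn + v)" and "M (nn + v) < W"
  shows "(step clique_program W ^^ 3) (conf 6 [n,l,k,1,nn,lb,lim,col,v,row,x,p,a,ae,e,u,c] M) =
    conf 38 [n,l,k,1,nn,lb,lim,col,v,row,M (nn + v),nn + v,a,ae,e,u,c] M"
  using assms by (simp add: exec register_file_def)

lemma run6_full:
  assumes "nn + v < W" and "M (nn + v) = 0" and "col = l"
  shows "(step clique_program W ^^ 4) (conf 6 [n,l,k,1,nn,lb,lim,col,v,row,x,p,a,ae,e,u,c] M) =
    conf 59 [n,l,k,1,nn,lb,lim,col,v,row,0,nn + v,a,ae,e,u,c] M"
  using assms by (simp add: exec register_file_def)

lemma run6_new:
  assumes "nn + v < W" and "M (nn + v) = 0" and "col \<noteq> l" and "Suc col < W" and "lb < W" and "row + v < W" and "row + n < W"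
  shows "(step clique_program W ^^ 9) (conf 6 [n,l,k,1,nn,lb,lim,col,v,row,x,p,a,ae,e,u,c] M) =
    conf 15 [n,l,k,1,nn,lb,lim,Suc col,v,row,0,nn + v,row + v,row + n,lb,u,c] (M(nn + v := Suc col))"
  using assms by (simp add: exec register_file_def)

lemma run15_end:
  assumes "Suc a < W" and "Suc a = ae"
  shows "(step clique_program W ^^ 2) (conf 15 [n,l,k,1,nn,lb,lim,col,v,row,x,p,a,ae,e,u,c] M) =
    conf 59 [n,l,k,1,nn,lb,lim,col,v,row,x,p,Suc a,ae,e,u,c] M"
  using assms by (simp add: exec register_file_def)

lemma run15_adjacent:
  assumes "Suc a < W" and "Suc a \<noteq> ae" and "M (Suc a) = 1" and "1 < W"
  shows "(step clique_program W ^^ 4) (conf 15 [n,l,k,1,nn,lb,lim,col,v,row,x,p,a,ae,e,u,c] M) =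
    conf 15 [n,l,k,1,nn,lb,lim,col,v,row,1,p,Suc a,ae,e,u,c] M"
  using assms by (simp add: exec register_file_def)

lemma run15_more:
  assumes "Suc a < W" and "Suc a \<noteq> ae" and "M (Suc a) = 0" and "Suc a - row < W" and "(Suc a - row) * n < W" and "Suc e < W" and "Suc e < lim"
  shows "(step clique_program W ^^ 9) (conf 15 [n,l,k,1,nn,lb,lim,col,v,row,x,p,a,ae,e,u,c] M) =
    conf 15 [n,l,k,1,nn,lb,lim,col,v,row,(Suc a - row) * n,p,Suc a,ae,Suc e,u,c] (M(e := (Suc a - row) * n))"
  using assms by (simp add: exec register_file_def)

lemma run15_last:
  assumes "Suc a < W" and "Suc a \<noteq> ae" and "M (Suc a) = 0" and "Suc a - row < W" and "(Suc a - row) * n < W" and "Suc e < W" and "\<not> Suc e < lim"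
  shows "(step clique_program W ^^ 9) (conf 15 [n,l,k,1,nn,lb,lim,col,v,row,x,p,a,ae,e,u,c] M) =
    conf 24 [n,l,k,1,nn,lb,lim,col,v,row,(Suc a - row) * n,p,Suc a,ae,Suc e,u,c] (M(e := (Suc a - row) * n))"
  using assms by (simp add: exec register_file_def)

lemma run24:
  assumes "0 < W"
  shows "(step clique_program W ^^ 1) (conf 24 [n,l,k,1,nn,lb,lim,col,v,row,x,p,a,ae,e,u,c] M) =
    conf 25 [n,l,k,1,nn,lb,lim,col,v,row,x,p,a,ae,e,0,c] M"
  using assms by (simp add: exec register_file_def)

lemma run25:
  assumes "0 < W" and "lb < W"
  shows "(step clique_program W ^^ 2) (conf 25 [n,l,k,1,nn,lb,lim,col,v,row,x,p,a,ae,e,u,c] M) =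
    conf 27 [n,l,k,1,nn,lb,lim,col,v,row,x,p,a,ae,lb,u,0] M"
  using assms by (simp add: exec register_file_def)

lemma run27_more:
  assumes "M e + u < W" and "M e < W" and "M (M e + u) < W" and "c + M (M e + u) < W" and "Suc e < W" and "Suc e < lim"
  shows "(step clique_program W ^^ 6) (conf 27 [n,l,k,1,nn,lb,lim,col,v,row,x,p,a,ae,e,u,c] M) =
    conf 27 [n,l,k,1,nn,lb,lim,col,v,row,M (M e + u),p,a,ae,Suc e,u,c + M (M e + u)] M"
  using assms by (simp add: exec register_file_def)

lemma run27_last:
  assumes "M e + u < W" and "M e < W" and "M (M e + u) < W" and "c + M (M e + u) < W" and "Suc e < W" and "\<not> Suc e < lim"
  shows "(step clique_program W ^^ 6) (conf 27 [n,l,k,1,nn,lb,lim,col,v,row,x,p,a,ae,e,u,c] M) =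
    conf 33 [n,l,k,1,nn,lb,lim,col,v,row,M (M e + u),p,a,ae,Suc e,u,c + M (M e + u)] M"
  using assms by (simp add: exec register_file_def)

lemma run33_skip:
  assumes "k < c"
  shows "(step clique_program W ^^ 1) (conf 33 [n,l,k,1,nn,lb,lim,col,v,row,x,p,a,ae,e,u,c] M) =
    conf 36 [n,l,k,1,nn,lb,lim,col,v,row,x,p,a,ae,e,u,c] M"
  using assms by (simp add: exec register_file_def)

lemma run33_colour:
  assumes "\<not> k < c" and "nn + u < W"
  shows "(step clique_program W ^^ 3) (conf 33 [n,l,k,1,nn,lb,lim,col,v,row,x,p,a,ae,e,u,c] M) =
    conf 36 [n,l,k,1,nn,lb,lim,col,v,row,x,nn + u,a,ae,e,u,c] (M(nn + u := col))"
  using assms by (simp add: exec register_file_def)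

lemma run36_more:
  assumes "Suc u < n" and "Suc u < W"
  shows "(step clique_program W ^^ 2) (conf 36 [n,l,k,1,nn,lb,lim,col,v,row,x,p,a,ae,e,u,c] M) =
    conf 25 [n,l,k,1,nn,lb,lim,col,v,row,x,p,a,ae,e,Suc u,c] M"
  using assms by (simp add: exec register_file_def)

lemma run36_last:
  assumes "\<not> Suc u < n" and "Suc u < W"
  shows "(step clique_program W ^^ 2) (conf 36 [n,l,k,1,nn,lb,lim,col,v,row,x,p,a,ae,e,u,c] M) =
    conf 38 [n,l,k,1,nn,lb,lim,col,v,row,x,p,a,ae,e,Suc u,c] M"
  using assms by (simp add: exec register_file_def)

lemma run38_more:
  assumes "Suc v < n" and "Suc v < W" and "row + n < W"
  shows "(step clique_program W ^^ 3) (conf 38 [n,l,k,1,nn,lb,lim,col,v,row,x,p,a,ae,e,u,c] M) =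
    conf 6 [n,l,k,1,nn,lb,lim,col,Suc v,row + n,x,p,a,ae,e,u,c] M"
  using assms by (simp add: exec register_file_def)

lemma run38_last:
  assumes "\<not> Suc v < n" and "Suc v < W" and "row + n < W"
  shows "(step clique_program W ^^ 3) (conf 38 [n,l,k,1,nn,lb,lim,col,v,row,x,p,a,ae,e,u,c] M) =
    conf 41 [n,l,k,1,nn,lb,lim,col,Suc v,row + n,x,p,a,ae,e,u,c] M"
  using assms by (simp add: exec register_file_def)

lemma run41:
  assumes "1 < W" and "n < W"
  shows "(step clique_program W ^^ 2) (conf 41 [n,l,k,1,nn,lb,lim,col,v,row,x,p,a,ae,e,u,c] M) =
    conf 43 [n,l,k,1,nn,lb,lim,col,v,n,x,p,a,ae,e,1,c] M"
  using assms by (simp add: exec register_file_def)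

lemma run43:
  assumes "nn + u < W" and "M (nn + u) < W" and "row < W" and "row + u < W" and "nn < W"
  shows "(step clique_program W ^^ 5) (conf 43 [n,l,k,1,nn,lb,lim,col,v,row,x,p,a,ae,e,u,c] M) =
    conf 48 [n,l,k,1,nn,lb,lim,col,v,row,x,nn + u,row,row + u,nn,u,M (nn + u)] M"
  using assms by (simp add: exec register_file_def)

lemma run48_nonadjacent:
  assumes "M a = 0" and "0 < W"
  shows "(step clique_program W ^^ 2) (conf 48 [n,l,k,1,nn,lb,lim,col,v,row,x,p,a,ae,e,u,c] M) =
    conf 52 [n,l,k,1,nn,lb,lim,col,v,row,0,p,a,ae,e,u,c] M"
  using assms by (simp add: exec register_file_def)

lemma run48_clash:
  assumes "M a = 1" and "M e = c" and "c < W" and "1 < W"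
  shows "(step clique_program W ^^ 4) (conf 48 [n,l,k,1,nn,lb,lim,col,v,row,x,p,a,ae,e,u,c] M) =
    conf 59 [n,l,k,1,nn,lb,lim,col,v,row,c,p,a,ae,e,u,c] M"
  using assms by (simp add: exec register_file_def)

lemma run48_proper:
  assumes "M a = 1" and "M e \<noteq> c" and "M e < W" and "1 < W"
  shows "(step clique_program W ^^ 4) (conf 48 [n,l,k,1,nn,lb,lim,col,v,row,x,p,a,ae,e,u,c] M) =
    conf 52 [n,l,k,1,nn,lb,lim,col,v,row,M e,p,a,ae,e,u,c] M"
  using assms by (simp add: exec register_file_def)

lemma run52_more:
  assumes "Suc a < W" and "Suc e < W" and "Suc a < ae"
  shows "(step clique_program W ^^ 3) (conf 52 [n,l,k,1,nn,lb,lim,col,v,row,x,p,a,ae,e,u,c] M) =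
    conf 48 [n,l,k,1,nn,lb,lim,col,v,row,x,p,Suc a,ae,Suc e,u,c] M"
  using assms by (simp add: exec register_file_def)

lemma run52_last:
  assumes "Suc a < W" and "Suc e < W" and "\<not> Suc a < ae"
  shows "(step clique_program W ^^ 3) (conf 52 [n,l,k,1,nn,lb,lim,col,v,row,x,p,a,ae,e,u,c] M) =
    conf 55 [n,l,k,1,nn,lb,lim,col,v,row,x,p,Suc a,ae,Suc e,u,c] M"
  using assms by (simp add: exec register_file_def)

lemma run55_more:
  assumes "Suc u < W" and "row + n < W" and "Suc u < n"
  shows "(step clique_program W ^^ 3) (conf 55 [n,l,k,1,nn,lb,lim,col,v,row,x,p,a,ae,e,u,c] M) =
    conf 43 [n,l,k,1,nn,lb,lim,col,v,row + n,x,p,a,ae,e,Suc u,c] M"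
  using assms by (simp add: exec register_file_def)

lemma run55_last:
  assumes "Suc u < W" and "row + n < W" and "\<not> Suc u < n"
  shows "(step clique_program W ^^ 3) (conf 55 [n,l,k,1,nn,lb,lim,col,v,row,x,p,a,ae,e,u,c] M) =
    conf 58 [n,l,k,1,nn,lb,lim,col,v,row + n,x,p,a,ae,e,Suc u,c] M"
  using assms by (simp add: exec register_file_def)

section \<open>Composing runs\<close>

text \<open>Runs are composed backwards. Later lemmas take the guarantee at the exit of a loop as
  hypothesis \<open>cont\<close> and return one at its entry; early halting then needs no separate
  description, and slack in the time bound is absorbed here.\<close>

lemma answers_steps:
  assumes "(step P W ^^ t) S = S'" "answers_within P W S' T b" "t + T \<le> T'"
  shows "answers_within P W S T' b"
proof -
  obtain t' where "t' \<le> T" "(step P W ^^ t') S' = Halted b"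
    using assms(2) by (auto simp: answers_within_def)
  then have "t' + t \<le> T' \<and> (step P W ^^ (t' + t)) S = Halted b"
    using assms(1,3) by (simp add: funpow_add)
  then show ?thesis unfolding answers_within_def by blast
qed

lemma answers_mono:
  "answers_within P W S T b \<Longrightarrow> T \<le> T' \<Longrightarrow> answers_within P W S T' b"
  unfolding answers_within_def by (meson le_trans)

lemma answers_reject: "\<not> b \<Longrightarrow> answers_within clique_program W (conf 58 xs M) 1 b"
  unfolding answers_within_def by (intro exI[of _ 1]) (simp add: clique_program_def)

lemma answers_accept: "b \<Longrightarrow> answers_within clique_program W (conf 59 xs M) 1 b"
  unfolding answers_within_def by (intro exI[of _ 1]) (simp add: clique_program_def)

section \<open>Correctness and running time\<close>

locale embed_run =
  fixes n l k :: nat and G :: "nat graph"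
  assumes inst: "embed_avg_instance (complete_graph (l + 1)) n k G"
    and l_ge: "2 \<le> l" and l_sq: "6 * l ^ 2 \<le> n" and k_small: "30 * k * l \<le> n"
begin

abbreviation "has_clique \<equiv> contains_copy G (complete_graph (l + 1))"

abbreviation "ans S T \<equiv> answers_within clique_program (n ^ 3) S T has_clique"

abbreviation "at i col v row x p a ae e u c M \<equiv>
  conf i [n,l,k,1,n * n,n * n + n,n * n + n + (2 * k + 1),col,v,row,x,p,a,ae,e,u,c] M"

text \<open>Cells from \<open>n * n + n\<close> on are left open, so storing the sample there
  preserves the relation.\<close>

definition encodes :: "(nat \<Rightarrow> nat) \<Rightarrow> (nat \<Rightarrow> nat) \<Rightarrow> bool" where
  "encodes M C \<longleftrightarrow> (\<forall>a<n * n. M a = adj_matrix n G a) \<and> (\<forall>u<n. M (n * n + u) = C u)"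

definition proper_upto :: "(nat \<Rightarrow> nat) \<Rightarrow> nat \<Rightarrow> bool" where
  "proper_upto C u \<longleftrightarrow> (\<forall>v<u. \<forall>w<v. {v, w} \<in> edges G \<longrightarrow> C v \<noteq> C w)"

lemma l12: "12 * l \<le> n"
proof -
  have "2 * l \<le> l * l" using l_ge by simp
  then show ?thesis using l_sq unfolding power2_eq_square by linarith
qed

lemma n_ge: "24 \<le> n" using l12 l_ge by linarith

lemma k60: "60 * k \<le> n"
proof -
  have "30 * k * 2 \<le> 30 * k * l" using l_ge by (intro mult_left_mono) auto
  then show ?thesis using k_small by linarith
qed

lemma sq_ge: "24 * n \<le> n * n" using n_ge by (rule mult_le_mono1)

text \<open>Every word bound is reduced to this: all addresses and values stay below a constant
  multiple of \<open>n * n\<close>, while \<open>n\<close> is at least 24.\<close>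

lemma lt_W: "x \<le> 3 * (n * n) \<Longrightarrow> x < n ^ 3"
proof -
  assume "x \<le> 3 * (n * n)"
  also have "\<dots> < n * (n * n)" using n_ge by (intro mult_strict_right_mono) auto
  finally show ?thesis by (simp add: power3_eq_cube)
qed

lemma row_le: "u < n \<Longrightarrow> u * n + n \<le> n * n"
  using mult_le_mono1[of "Suc u" n n] by simp

lemma encodes_colour: "encodes M C \<Longrightarrow> u < n \<Longrightarrow> M (n * n + u) = C u"
  by (simp add: encodes_def)

lemma encodes_adj:
  assumes "encodes M C" "u < n" "w < n"
  shows "M (u * n + w) = of_bool ({u, w} \<in> edges G)"
proof -
  have "u * n + w < n * n" using row_le[OF assms(2)] assms(3) by linarith
  moreover have "(u * n + w) div n = u" "(u * n + w) mod n = w" using assms(3) by auto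
  ultimately show ?thesis using assms(1) by (simp add: encodes_def adj_matrix_def)
qed

lemma encodes_upd_colour:
  "encodes M C \<Longrightarrow> u < n \<Longrightarrow> encodes (M(n * n + u := y)) (C(u := y))"
  by (auto simp: encodes_def)

lemma encodes_upd_above: "encodes M C \<Longrightarrow> n * n + n \<le> e \<Longrightarrow> encodes (M(e := y)) C"
  by (auto simp: encodes_def)

lemma edge_lt: "{u, w} \<in> edges G \<Longrightarrow> u < n \<and> w < n \<and> u \<noteq> w"
  using inst by (auto simp: embed_avg_instance_def simple_graph_def doubleton_eq_iff)

lemma proper_imp_no_copy:
  assumes "\<And>u. u < n \<Longrightarrow> 0 < C u \<and> C u \<le> l" "proper_upto C n"
  shows "\<not> has_clique"
proof (rule coloring_imp_no_clique[where C = C and Y = "{1..l}"])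
  show "C ` verts G \<subseteq> {1..l}"
    using assms(1) inst by (auto simp: embed_avg_instance_def Suc_le_eq)
next
  fix u v assume "{u, v} \<in> edges G"
  then show "C u \<noteq> C v"
    using assms(2) edge_lt[of u v] insert_commute[of u v "{}"]
    by (cases u v rule: linorder_cases) (fastforce simp: proper_upto_def)+
qed auto

section \<open>The final check of the colouring\<close>

text \<open>\<open>clash\<close> makes \<open>Accept\<close> correct at a monochromatic edge, and
  \<open>1 \<le> T\<close> pays for that instruction. The longest of the three paths takes 4
  steps.\<close>

lemma verify_pair:
  assumes enc: "encodes M C" and C: "\<And>w. w < n \<Longrightarrow> C w \<le> l" and "u < n" "w < u"
    and clash: "{u, w} \<in> edges G \<Longrightarrow> C u = C w \<Longrightarrow> has_clique"
    and cont: "\<And>x. ({u, w} \<in> edges G \<longrightarrow> C u \<noteq> C w) \<Longrightarrow>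
      ans (at 52 col v row x p (u * n + w) ae (n * n + w) u (C u) M) T"
    and "1 \<le> T"
  shows "ans (at 48 col v row x p (u * n + w) ae (n * n + w) u (C u) M) (4 + T)"
proof -
  have w: "w < n" using assms by simp
  have Cw: "M (n * n + w) = C w" using encodes_colour[OF enc w] .
  have small: "C u < n ^ 3" "C w < n ^ 3" "0 < n ^ 3" "1 < n ^ 3"
    by (rule lt_W, use C[OF \<open>u < n\<close>] C[OF w] l12 n_ge sq_ge in linarith)+
  note adj = encodes_adj[OF enc \<open>u < n\<close> w]
  consider "{u, w} \<notin> edges G" | "{u, w} \<in> edges G" "C u = C w" | "{u, w} \<in> edges G" "C u \<noteq> C w"
    by auto
  then show ?thesis
  proof cases
    case 1
    show ?thesis
      by (rule answers_steps[OF run48_nonadjacent cont]) (use 1 adj small in auto)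
  next
    case 2
    show ?thesis
      by (rule answers_steps[OF run48_clash answers_accept]) (use 2 adj small Cw clash assms in auto)
  next
    case 3
    show ?thesis
      by (rule answers_steps[OF run48_proper cont]) (use 3 adj small Cw in auto)
  qed
qed

text \<open>Induction on the number of pairs still to be checked, each costing \<open>4 + 3\<close>
  steps. The loop test comes after the body, so there is always at least one pair; this is why the
  outer loop starts at vertex 1.\<close>

lemma verify_row:
  assumes enc: "encodes M C" and C: "\<And>w. w < n \<Longrightarrow> C w \<le> l" and "u < n"
    and clash: "\<And>w. w < u \<Longrightarrow> {u, w} \<in> edges G \<Longrightarrow> C u = C w \<Longrightarrow> has_clique"
    and cont: "\<And>x a e. (\<And>w. w < u \<Longrightarrow> {u, w} \<in> edges G \<Longrightarrow> C u \<noteq> C w) \<Longrightarrow>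
      ans (at 55 col v row x p a ae e u (C u) M) T"
    and ae: "ae = u * n + u"
    and "u = j + Suc d" and "\<And>w. w < j \<Longrightarrow> {u, w} \<in> edges G \<Longrightarrow> C u \<noteq> C w"
  shows "ans (at 48 col v row x p (u * n + j) ae (n * n + j) u (C u) M) (7 * Suc d + T)"
  using assms(7,8)
proof (induction d arbitrary: j x)
  case 0
  have small: "Suc (u * n + j) < n ^ 3" "Suc (n * n + j) < n ^ 3"
    by (rule lt_W, use row_le[OF \<open>u < n\<close>] \<open>u < n\<close> 0 sq_ge n_ge in linarith)+
  have "ans (at 48 col v row x p (u * n + j) ae (n * n + j) u (C u) M) (4 + (3 + T))"
  proof (rule verify_pair[OF enc C \<open>u < n\<close>])
    fix x assume *: "{u, j} \<in> edges G \<longrightarrow> C u \<noteq> C j"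
    show "ans (at 52 col v row x p (u * n + j) ae (n * n + j) u (C u) M) (3 + T)"
    proof (rule answers_steps[OF run52_last cont])
      show "C u \<noteq> C w" if "w < u" "{u, w} \<in> edges G" for w
        using that 0 * by (cases "w = j") auto
    qed (use small ae 0 in auto)
  qed (use 0 clash in auto)
  then show ?case by simp
next
  case (Suc d)
  have small: "Suc (u * n + j) < n ^ 3" "Suc (n * n + j) < n ^ 3"
    by (rule lt_W, use row_le[OF \<open>u < n\<close>] \<open>u < n\<close> Suc.prems(1) sq_ge n_ge in linarith)+
  have "ans (at 48 col v row x p (u * n + j) ae (n * n + j) u (C u) M) (4 + (3 + (7 * Suc d + T)))"
  proof (rule verify_pair[OF enc C \<open>u < n\<close>])
    fix x assume *: "{u, j} \<in> edges G \<longrightarrow> C u \<noteq> C j"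
    have next_pair: "ans (at 48 col v row x p (Suc (u * n + j)) ae (Suc (n * n + j)) u (C u) M) (7 * Suc d + T)"
      unfolding add_Suc_right[symmetric]
    proof (rule Suc.IH)
      show "C u \<noteq> C w" if "w < Suc j" "{u, w} \<in> edges G" for w
        using that Suc.prems * by (cases "w = j") auto
    qed (use Suc.prems in simp)
    show "ans (at 52 col v row x p (u * n + j) ae (n * n + j) u (C u) M) (3 + (7 * Suc d + T))"
      by (rule answers_steps[OF run52_more next_pair]) (use small ae Suc.prems in auto)
  qed (use Suc.prems(1) clash[of j] in auto)
  then show ?case by (simp add: add.assoc)
qed

lemma verify_vertex:
  assumes enc: "encodes M C" and C: "\<And>w. w < n \<Longrightarrow> C w \<le> l" and u: "u < n" "0 < u"
    and clash: "\<not> has_clique \<Longrightarrow> proper_upto C n" and "proper_upto C u"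
    and cont: "\<And>x p a ae e c. proper_upto C (Suc u) \<Longrightarrow> ans (at 55 col v (u * n) x p a ae e u c M) T"
  shows "ans (at 43 col v (u * n) x p a ae e u c M) (5 + (7 * u + T))"
proof -
  have small: "n * n + u < n ^ 3" "C u < n ^ 3" "u * n < n ^ 3" "u * n + u < n ^ 3" "n * n < n ^ 3"
    by (rule lt_W, use row_le[OF u(1)] C[OF u(1)] u sq_ge n_ge l12 in linarith)+
  have row: "ans (at 48 col v (u * n) x (n * n + u) (u * n + 0) (u * n + u) (n * n + 0) u (C u) M)
      (7 * Suc (u - 1) + T)" for x
  proof (rule verify_row[OF enc C u(1)])
    show "has_clique" if "w < u" "{u, w} \<in> edges G" "C u = C w" for w
      using that clash u by (auto simp: proper_upto_def)
    fix x a e assume "\<And>w. w < u \<Longrightarrow> {u, w} \<in> edges G \<Longrightarrow> C u \<noteq> C w"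
    then show "ans (at 55 col v (u * n) x (n * n + u) a (u * n + u) e u (C u) M) T"
      using cont assms(6) by (auto simp: proper_upto_def less_Suc_eq)
  qed (use u in auto)
  show ?thesis
    by (rule answers_steps[OF run43])
      (use small encodes_colour[OF enc u(1)] row u in auto)
qed

text \<open>Reaching \<open>Reject\<close> needs no partition: a checked proper colouring with
  colours 1 to \<open>l\<close> excludes the clique. Vertex \<open>i\<close> costs
  \<open>5 + 7 * i + 3\<close> steps, and the extra 1 is the \<open>Reject\<close>.\<close>

lemma verify:
  assumes enc: "encodes M C" and C: "\<And>w. w < n \<Longrightarrow> 0 < C w \<and> C w \<le> l"
    and clash: "\<not> has_clique \<Longrightarrow> proper_upto C n"
    and "n = u + Suc d" "0 < u" "proper_upto C u"
  shows "ans (at 43 col v (u * n) x p a ae e u c M) (1 + (\<Sum>i=u..<n. 8 + 7 * i))"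
  using assms(4-)
proof (induction d arbitrary: u x p a ae e c)
  case (0 u)
  then have u: "u < n" by simp
  have small: "Suc u < n ^ 3" "u * n + n < n ^ 3"
    by (rule lt_W, use row_le[OF u] u sq_ge n_ge in linarith)+
  have last: "ans (at 55 col v (u * n) x p a ae e u c M) 4" if "proper_upto C (Suc u)" for x p a ae e c
  proof -
    have "\<not> has_clique" using proper_imp_no_copy[of C] C that 0 by simp
    then show ?thesis
      by (intro answers_steps[OF run55_last answers_reject]) (use small 0 in auto)
  qed
  have "ans (at 43 col v (u * n) x p a ae e u c M) (5 + (7 * u + 4))"
    by (rule verify_vertex[OF enc _ u]) (use C clash 0 last in auto)
  then show ?case using 0 by (simp add: add.commute)
next
  case (Suc d u)
  then have u: "u < n" by simp
  have small: "Suc u < n ^ 3" "u * n + n < n ^ 3"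
    by (rule lt_W, use row_le[OF u] u sq_ge n_ge in linarith)+
  let ?T = "1 + (\<Sum>i=Suc u..<n. 8 + 7 * i)"
  have more: "ans (at 55 col v (u * n) x p a ae e u c M) (3 + ?T)" if "proper_upto C (Suc u)"
    for x p a ae e c
  proof (rule answers_steps[OF run55_more])
    have "ans (at 43 col v (Suc u * n) x p a ae e (Suc u) c M) ?T"
      by (rule Suc.IH) (use Suc.prems that in auto)
    then show "ans (at 43 col v (u * n + n) x p a ae e (Suc u) c M) ?T"
      by (simp add: add.commute)
  qed (use small Suc.prems in auto)
  have "ans (at 43 col v (u * n) x p a ae e u c M) (5 + (7 * u + (3 + ?T)))"
    by (rule verify_vertex[OF enc _ u]) (use C clash Suc.prems more in auto)
  then show ?case by (rule answers_mono) (simp add: sum.atLeast_Suc_lessThan[OF u])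
qed

section \<open>Voting by the sample\<close>

definition listed :: "(nat \<Rightarrow> nat) \<Rightarrow> (nat \<Rightarrow> nat) \<Rightarrow> nat \<Rightarrow> bool" where
  "listed M S m \<longleftrightarrow> (\<forall>j<m. M (n * n + n + j) = S j * n)"

text \<open>Counting indices instead of vertices makes this the value of the counter register after
  \<open>m\<close> sample entries, for any \<open>S\<close>.\<close>

definition sample_degree :: "(nat \<Rightarrow> nat) \<Rightarrow> nat \<Rightarrow> nat \<Rightarrow> nat" where
  "sample_degree S m w = card {j. j < m \<and> {S j, w} \<in> edges G}"

text \<open>The parameter \<open>u\<close> makes this a loop invariant: the vertices below
  \<open>u\<close> have been processed. Older colours may be overwritten too; in the clique-free
  case the vote never selects such a vertex.\<close>

definition recolour :: "(nat \<Rightarrow> nat) \<Rightarrow> nat \<Rightarrow> nat \<Rightarrow> (nat \<Rightarrow> nat) \<Rightarrow> nat \<Rightarrow> nat" where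
  "recolour S y u C w = (if w < u \<and> sample_degree S (2 * k + 1) w \<le> k then y else C w)"

lemma sample_degree_Suc:
  "sample_degree S (Suc m) w = sample_degree S m w + of_bool ({S m, w} \<in> edges G)"
proof -
  have "{j. j < Suc m \<and> {S j, w} \<in> edges G} =
      {j. j < m \<and> {S j, w} \<in> edges G} \<union> (if {S m, w} \<in> edges G then {m} else {})"
    by (auto simp: less_Suc_eq)
  then show ?thesis by (simp add: sample_degree_def)
qed

lemma sample_degree_le: "sample_degree S m w \<le> m"
  unfolding sample_degree_def using card_mono[of "{..<m}" "{j. j < m \<and> {S j, w} \<in> edges G}"] by auto

lemma scan_sample_valueue:
  assumes enc: "encodes M C" and S: "listed M S (2 * k + 1)" "\<And>j. j < 2 * k + 1 \<Longrightarrow> S j < n"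
    and u: "u < n" and j: "j < 2 * k + 1"
  shows "sample_degree S j u + M (M (n * n + n + j) + u) = sample_degree S (Suc j) u"
    and "M (n * n + n + j) + u < n ^ 3" "M (n * n + n + j) < n ^ 3"
    and "M (M (n * n + n + j) + u) < n ^ 3" "sample_degree S (Suc j) u < n ^ 3"
    and "Suc (n * n + n + j) < n ^ 3"
proof -
  have S1: "M (n * n + n + j) = S j * n" using S(1) j by (simp add: listed_def)
  have S2: "M (M (n * n + n + j) + u) = of_bool ({S j, u} \<in> edges G)"
    unfolding S1 by (rule encodes_adj[OF enc S(2)[OF j] u])
  show "sample_degree S j u + M (M (n * n + n + j) + u) = sample_degree S (Suc j) u"
    unfolding S2 sample_degree_Suc ..
  have le: "M (M (n * n + n + j) + u) \<le> 1" unfolding S2 by simp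
  show "M (n * n + n + j) + u < n ^ 3" "M (n * n + n + j) < n ^ 3"
    and "M (M (n * n + n + j) + u) < n ^ 3" "sample_degree S (Suc j) u < n ^ 3"
    and "Suc (n * n + n + j) < n ^ 3"
    by (rule lt_W, use S1 le row_le[OF S(2)[OF j]] u j sample_degree_le[of S "Suc j" u] k60 sq_ge n_ge
      in linarith)+
qed

lemma scan_sample:
  assumes enc: "encodes M C" and S: "listed M S (2 * k + 1)" "\<And>j. j < 2 * k + 1 \<Longrightarrow> S j < n"
    and u: "u < n"
    and cont: "\<And>x e. ans (at 33 col v row x p a ae e u (sample_degree S (2 * k + 1) u) M) T"
    and "2 * k + 1 = j + Suc d"
  shows "ans (at 27 col v row x p a ae (n * n + n + j) u (sample_degree S j u) M) (6 * Suc d + T)"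
  using assms(6)
proof (induction d arbitrary: j x)
  case (0 j)
  then have q: "2 * k + 1 = Suc j" by simp
  note val = scan_sample_valueue[OF enc S u, of j]
  have "ans (at 33 col v row x p a ae e u (sample_degree S j u + M (M (n * n + n + j) + u)) M) T"
    for x e
    using cont val(1) q by simp
  then have "ans (at 27 col v row x p a ae (n * n + n + j) u (sample_degree S j u) M) (6 + T)"
    by (intro answers_steps[OF run27_last]) (use val q in auto)
  then show ?case by simp
next
  case (Suc d j)
  then have j: "j < 2 * k + 1" by simp
  note val = scan_sample_valueue[OF enc S u, of j]
  have "ans (at 27 col v row x p a ae (n * n + n + Suc j) u (sample_degree S (Suc j) u) M)
      (6 * Suc d + T)" for x
    by (rule Suc.IH) (use Suc.prems in simp)
  then have tail: "ans (at 27 col v row x p a ae (Suc (n * n + n + j)) u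
      (sample_degree S j u + M (M (n * n + n + j) + u)) M) (6 * Suc d + T)" for x
    using val(1) j by simp
  have "ans (at 27 col v row x p a ae (n * n + n + j) u (sample_degree S j u) M)
      (6 + (6 * Suc d + T))"
    by (rule answers_steps[OF run27_more tail]) (use val j Suc.prems in auto)
  then show ?case by (simp add: add.assoc)
qed

lemma recolour_Suc:
  "recolour S y (Suc u) C = (recolour S y u C)
    (u := if sample_degree S (2 * k + 1) u \<le> k then y else recolour S y u C u)"
  by (auto simp: recolour_def fun_eq_iff less_Suc_eq)

lemma listed_upd_colour: "listed M S m \<Longrightarrow> u < n \<Longrightarrow> listed (M(n * n + u := y)) S m"
  by (auto simp: listed_def)

lemma classify_vertex:
  assumes enc: "encodes M C" and S: "listed M S (2 * k + 1)" "\<And>j. j < 2 * k + 1 \<Longrightarrow> S j < n"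
    and u: "u < n"
    and cont: "\<And>x p e c M'. encodes M' (C(u := if sample_degree S (2 * k + 1) u \<le> k then col else C u))
      \<Longrightarrow> listed M' S (2 * k + 1) \<Longrightarrow> ans (at 36 col v row x p a ae e u c M') T"
  shows "ans (at 25 col v row x p a ae e u c M) (6 * (2 * k + 1) + 5 + T)"
proof -
  have small: "n * n + u < n ^ 3" "n * n + n < n ^ 3" "0 < n ^ 3"
    by (rule lt_W, use u sq_ge n_ge in linarith)+
  let ?s = "sample_degree S (2 * k + 1) u"
  have "ans (at 33 col v row x p a ae e u ?s M) (3 + T)" for x p e
  proof (cases "k < ?s")
    case True
    then have "C = C(u := if ?s \<le> k then col else C u)" by auto
    then have "ans (at 36 col v row x p a ae e u ?s M) T"
      using enc S(1) by (intro cont) auto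
    then show ?thesis
      by (intro answers_steps[OF run33_skip]) (use True in auto)
  next
    case False
    have "ans (at 36 col v row x (n * n + u) a ae e u ?s (M(n * n + u := col))) T"
      using False encodes_upd_colour[OF enc u] listed_upd_colour[OF S(1) u]
      by (intro cont) auto
    then show ?thesis
      by (intro answers_steps[OF run33_colour]) (use False small in auto)
  qed
  then have "ans (at 27 col v row x p a ae (n * n + n + 0) u (sample_degree S 0 u) M)
      (6 * Suc (2 * k) + (3 + T))" for x p
    by (intro scan_sample[OF enc S u]) auto
  then have "ans (at 27 col v row x p a ae (n * n + n) u 0 M) (6 * Suc (2 * k) + (3 + T))" for x p
    by (simp add: sample_degree_def)
  then show ?thesis
    by (intro answers_steps[OF run25]) (use small in auto)
qed

lemma classify:
  assumes "encodes M (recolour S col u C)" and "listed M S (2 * k + 1)"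
    and S: "\<And>j. j < 2 * k + 1 \<Longrightarrow> S j < n"
    and cont: "\<And>x p e u c M'. encodes M' (recolour S col n C) \<Longrightarrow>
      ans (at 38 col v row x p a ae e u c M') T"
    and "n = u + Suc d"
  shows "ans (at 25 col v row x p a ae e u c M) ((6 * (2 * k + 1) + 7) * Suc d + T)"
  using assms(1,2,5)
proof (induction d arbitrary: u x p e c M)
  case (0 u)
  have small: "Suc u < n ^ 3"
    by (rule lt_W, use 0 sq_ge n_ge in linarith)
  have "ans (at 25 col v row x p a ae e u c M) (6 * (2 * k + 1) + 5 + (2 + T))"
  proof (rule classify_vertex[OF 0(1,2) S])
    fix x p e c M'
    assume "encodes M' ((recolour S col u C)(u := if sample_degree S (2 * k + 1) u \<le> k then col
        else recolour S col u C u))"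
    then have enc: "encodes M' (recolour S col n C)" using 0 by (simp add: recolour_Suc)
    show "ans (at 36 col v row x p a ae e u c M') (2 + T)"
      by (rule answers_steps[OF run36_last cont[OF enc]]) (use small 0 in auto)
  qed (use 0 in auto)
  then show ?case by (rule answers_mono) simp
next
  case (Suc d u)
  have small: "Suc u < n ^ 3"
    by (rule lt_W, use Suc.prems sq_ge n_ge in linarith)
  let ?T = "(6 * (2 * k + 1) + 7) * Suc d + T"
  have "ans (at 25 col v row x p a ae e u c M) (6 * (2 * k + 1) + 5 + (2 + ?T))"
  proof (rule classify_vertex[OF Suc.prems(1,2) S])
    fix x p e c M'
    assume "encodes M' ((recolour S col u C)(u := if sample_degree S (2 * k + 1) u \<le> k then col
        else recolour S col u C u))" "listed M' S (2 * k + 1)"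
    then have "ans (at 25 col v row x p a ae e (Suc u) c M') ?T"
      using Suc.prems(3) by (intro Suc.IH) (simp_all only: recolour_Suc add_Suc_right add_Suc)
    then show "ans (at 36 col v row x p a ae e u c M') (2 + ?T)"
      by (intro answers_steps[OF run36_more]) (use small Suc.prems(3) in auto)
  qed (use Suc.prems(3) in auto)
  then show ?case by (rule answers_mono) simp
qed

section \<open>Collecting the sample\<close>

text \<open>Vertices before \<open>v\<close> are already coloured, so in the clique-free case the
  whole part of the uncoloured \<open>v\<close> is found from \<open>v\<close> on.\<close>

definition later_nonneighbours :: "nat \<Rightarrow> nat set" where
  "later_nonneighbours v = {w. v < w \<and> w < n \<and> {v, w} \<notin> edges G}"

text \<open>The invariant is that the sample consists of the non-neighbours among
  \<open>v + 1\<close> to \<open>i\<close>. If the row ends first, the sample is all of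
  \<open>later_nonneighbours v\<close>, and \<open>few\<close> justifies \<open>Accept\<close>. Each
  vertex costs 4 steps, and each one stored 5 more.\<close>

lemma collect:
  assumes v: "v < n" and few: "card (later_nonneighbours v) < 2 * k + 1 \<Longrightarrow> has_clique"
    and cont: "\<And>x a M S. encodes M C \<Longrightarrow> listed M S (2 * k + 1) \<Longrightarrow> inj_on S {..<2 * k + 1} \<Longrightarrow>
      S ` {..<2 * k + 1} \<subseteq> later_nonneighbours v \<Longrightarrow>
      ans (at 24 col v (v * n) x p a (v * n + n) (n * n + n + (2 * k + 1)) u c M) T"
    and "encodes M C" "listed M S m" "inj_on S {..<m}"
    and "S ` {..<m} = {w \<in> later_nonneighbours v. w \<le> i}"
    and "m < 2 * k + 1" "n = i + Suc d" "v \<le> i"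
  shows "ans (at 15 col v (v * n) x p (v * n + i) (v * n + n) (n * n + n + m) u c M)
    (4 * Suc d + 5 * (2 * k + 1 - m) + T)"
  using assms(4-)
proof (induction d arbitrary: i m M S x)
  case (0 i)
  have small: "Suc (v * n + i) < n ^ 3"
    by (rule lt_W, use 0 row_le[OF v] sq_ge n_ge in linarith)
  have "{w \<in> later_nonneighbours v. w \<le> i} = later_nonneighbours v"
    unfolding later_nonneighbours_def using 0(6) by auto
  then have "card (later_nonneighbours v) = m"
    using 0 by (metis card_image card_lessThan)
  then have has_clique using few 0 by simp
  then show ?case
    by (intro answers_steps[OF run15_end answers_accept]) (use small 0 in auto)
next
  case (Suc d i)
  let ?w = "Suc i"
  have w: "?w < n" using Suc.prems by simp
  have idx: "Suc (v * n + i) - v * n = ?w" "Suc (v * n + i) = v * n + ?w" by simp_all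
  have "?w * n \<le> n * n" using w by (intro mult_le_mono1) simp
  then have small: "v * n + ?w < n ^ 3" "?w < n ^ 3" "?w * n < n ^ 3" "Suc (n * n + n + m) < n ^ 3" "1 < n ^ 3"
    by - (rule lt_W, use Suc.prems(5,6) w row_le[OF v] k60 sq_ge n_ge in linarith)+
  have adj: "M (v * n + ?w) = of_bool ({v, ?w} \<in> edges G)"
    using Suc.prems(1) v w by (rule encodes_adj)
  show ?case
  proof (cases "{v, ?w} \<in> edges G")
    case True
    have same: "{w \<in> later_nonneighbours v. w \<le> ?w} = {w \<in> later_nonneighbours v. w \<le> i}"
      using True by (auto simp: later_nonneighbours_def le_Suc_eq)
    have "ans (at 15 col v (v * n) x p (v * n + ?w) (v * n + n) (n * n + n + m) u c M)
        (4 * Suc d + 5 * (2 * k + 1 - m) + T)" for x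
      by (rule Suc.IH[OF Suc.prems(1-3)]) (use same Suc.prems(4-7) in simp_all)
    then have tail: "ans (at 15 col v (v * n) x p (Suc (v * n + i)) (v * n + n) (n * n + n + m) u c M)
        (4 * Suc d + 5 * (2 * k + 1 - m) + T)" for x
      unfolding idx .
    show ?thesis
      by (rule answers_steps[OF run15_adjacent tail]) (use small adj True w in auto)
  next
    case False
    let ?M = "M(n * n + n + m := ?w * n)"
    let ?S = "S(m := ?w)"
    have enc: "encodes ?M C" using Suc.prems(1) by (rule encodes_upd_above) simp
    have lis: "listed ?M ?S (Suc m)"
      using Suc.prems(2) by (auto simp: listed_def less_Suc_eq)
    have im: "?S ` {..<Suc m} = {w \<in> later_nonneighbours v. w \<le> ?w}"
    proof -
      have "?S ` {..<Suc m} = insert ?w (S ` {..<m})" by (auto simp: lessThan_Suc)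
      also have "\<dots> = {w \<in> later_nonneighbours v. w \<le> ?w}"
        unfolding Suc.prems(4) using False w Suc.prems(7)
        by (auto simp: later_nonneighbours_def le_Suc_eq)
      finally show ?thesis .
    qed
    have sub: "?S ` {..<Suc m} \<subseteq> later_nonneighbours v" unfolding im by auto
    have inj: "inj_on ?S {..<Suc m}"
    proof -
      have "?w \<notin> S ` {..<m}" unfolding Suc.prems(4) by simp
      moreover have "inj_on ?S {..<m}" "?S ` {..<m} = S ` {..<m}"
        using Suc.prems(3) by (auto simp: inj_on_def)
      ultimately show ?thesis by (simp add: lessThan_Suc)
    qed
    show ?thesis
    proof (cases "Suc m < 2 * k + 1")
      case True
      have "ans (at 15 col v (v * n) x p (v * n + ?w) (v * n + n) (n * n + n + Suc m) u c ?M)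
          (4 * Suc d + 5 * (2 * k + 1 - Suc m) + T)" for x
        by (rule Suc.IH[OF enc lis inj im True]) (use Suc.prems(6,7) in simp_all)
      then have tail: "ans (at 15 col v (v * n) x p (Suc (v * n + i)) (v * n + n) (Suc (n * n + n + m)) u c
          (M(n * n + n + m := (Suc (v * n + i) - v * n) * n)))
          (4 * Suc d + 5 * (2 * k + 1 - Suc m) + T)" for x
        unfolding idx by simp
      show ?thesis
        by (rule answers_steps[OF run15_more tail]) (use small adj False w True in auto)
    next
      case last: False
      then have q: "2 * k + 1 = Suc m" using Suc.prems(5) by simp
      have "ans (at 24 col v (v * n) x p (v * n + ?w) (v * n + n) (n * n + n + (2 * k + 1)) u c ?M) T" for x
        by (rule cont[OF enc, where S = ?S]; unfold q) (use lis inj sub in blast)+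
      then have tail: "ans (at 24 col v (v * n) x p (Suc (v * n + i)) (v * n + n) (Suc (n * n + n + m)) u c
          (M(n * n + n + m := (Suc (v * n + i) - v * n) * n))) T" for x
        unfolding idx q by simp
      show ?thesis
        by (rule answers_steps[OF run15_last tail]) (use small adj False w last q in auto)
    qed
  qed
qed

text \<open>Each wrong vote is a missing crossing pair that contains \<open>u\<close> or \<open>v\<close>. These pairs are distinct
  because the sample does not contain \<open>v\<close>.\<close>

lemma sample_classifies:
  assumes part: "almost_complete_partition n l k G c" and "v < n" "u < n"
    and inj: "inj_on S {..<2 * k + 1}" and S: "S ` {..<2 * k + 1} \<subseteq> later_nonneighbours v"
  shows "sample_degree S (2 * k + 1) u \<le> k \<longleftrightarrow> c u = c v"
proof -
  let ?q = "2 * k + 1"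
  define D where "D = edges (multipartite n c) - edges G"
  have D: "card D \<le> k" and finD: "finite D"
    using part by (auto simp: almost_complete_partition_def D_def finite_multipartite_edges)
  have Sj: "S j < n \<and> {v, S j} \<notin> edges G \<and> S j \<noteq> v" if "j < ?q" for j
    using that S by (auto simp: later_nonneighbours_def)
  have missing: "{x, y} \<in> D" if "x < n" "y < n" "c x \<noteq> c y" "{x, y} \<notin> edges G" for x y
    using that by (simp add: D_def multipartite_edge_iff)
  have cross: "c x \<noteq> c y" if "{x, y} \<in> edges G" for x y
    using that part multipartite_edge_iff[of x y n c] by (auto simp: almost_complete_partition_def)
  have inj': "i = j" if "i < ?q" "j < ?q" "S i = S j" for i j
    using inj that by (simp add: inj_on_def)
  show ?thesis
  proof
    assume same: "c u = c v"
    \<comment> \<open>A sample vertex adjacent to \<open>u\<close> lies outside the common part of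
      \<open>u\<close> and \<open>v\<close>, yet is not adjacent to \<open>v\<close>.\<close>
    have "sample_degree S ?q u \<le> card D"
      unfolding sample_degree_def
    proof (rule card_inj_on_le[where f = "\<lambda>j. {v, S j}"])
      show "inj_on (\<lambda>j. {v, S j}) {j. j < ?q \<and> {S j, u} \<in> edges G}"
        using inj' by (auto simp: inj_on_def doubleton_eq_iff)
      show "(\<lambda>j. {v, S j}) ` {j. j < ?q \<and> {S j, u} \<in> edges G} \<subseteq> D"
        using same Sj cross \<open>v < n\<close> by (auto intro!: missing) metis
    qed (rule finD)
    then show "sample_degree S ?q u \<le> k" using D by simp
  next
    assume le: "sample_degree S ?q u \<le> k"
    show "c u = c v"
    proof (rule ccontr)
      assume diff: "c u \<noteq> c v"
      let ?N = "{j. j < ?q \<and> {S j, u} \<notin> edges G}"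
      \<comment> \<open>A sample vertex not adjacent to \<open>u\<close> misses \<open>u\<close> if
        it lies in the part of \<open>v\<close>, and otherwise misses \<open>v\<close>. If
        \<open>{u, S i} = {v, S j}\<close>, then \<open>S i = v\<close> because \<open>u\<close> and
        \<open>v\<close> differ, which is excluded.\<close>
      let ?f = "\<lambda>j. if c (S j) = c v then {u, S j} else {v, S j}"
      have "card ?N \<le> card D"
      proof (rule card_inj_on_le[where f = ?f])
        show "inj_on ?f ?N"
        proof (rule inj_onI)
          fix i j assume ij: "i \<in> ?N" "j \<in> ?N" "?f i = ?f j"
          have "S i = S j"
            using ij(3) diff Sj[of i] Sj[of j] ij(1,2) by (auto simp: doubleton_eq_iff split: if_splits)
          then show "i = j" using inj' ij(1,2) by simp
        qed
        show "?f ` ?N \<subseteq> D"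
          using diff Sj \<open>u < n\<close> \<open>v < n\<close> by (auto intro!: missing simp: insert_commute)
      qed (rule finD)
      \<comment> \<open>At most \<open>k\<close> of the \<open>2 * k + 1\<close> votes are adjacent
        to \<open>u\<close>, so \<open>?N\<close> has at least \<open>k + 1\<close> elements, more
        than \<open>D\<close>.\<close>
      moreover have "sample_degree S ?q u + card ?N = ?q"
      proof -
        have "sample_degree S ?q u + card ?N = card ({j. j < ?q \<and> {S j, u} \<in> edges G} \<union> ?N)"
          unfolding sample_degree_def by (intro card_Un_disjoint[symmetric]) auto
        also have "{j. j < ?q \<and> {S j, u} \<in> edges G} \<union> ?N = {..<?q}" by auto
        finally show ?thesis by simp
      qed
      ultimately show False using le D by linarith
    qed
  qed
qed

text \<open>The second conjunct is what limits the number of colours to \<open>l\<close>.\<close>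

definition tracks :: "(nat \<Rightarrow> nat) \<Rightarrow> (nat \<Rightarrow> nat) \<Rightarrow> nat \<Rightarrow> bool" where
  "tracks c C col \<longleftrightarrow> (\<forall>u<n. \<forall>w<n. C u \<noteq> 0 \<longrightarrow> (C u = C w \<longleftrightarrow> c u = c w)) \<and>
     col = card (c ` {u. u < n \<and> C u \<noteq> 0})"

lemma tracks_new:
  assumes "tracks c C col" "v < n" "C v = 0" "w < n" "C w \<noteq> 0"
  shows "c w \<noteq> c v"
  using assms unfolding tracks_def by metis

text \<open>The part of an uncoloured vertex is not among the coloured ones. Hence running out of
  colours proves a clique, which justifies \<open>Accept\<close> there.\<close>

lemma tracks_less:
  assumes part: "almost_complete_partition n l k G c" and "tracks c C col" "v < n" "C v = 0"
  shows "col < l"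
proof -
  have "c ` {u. u < n \<and> C u \<noteq> 0} \<subseteq> {..<l} - {c v}"
    using part tracks_new[OF assms(2-4)] by (auto simp: almost_complete_partition_def)
  then have "col \<le> card ({..<l} - {c v})"
    using assms(2) unfolding tracks_def by (metis card_mono finite_Diff finite_lessThan)
  moreover have "c v < l" using part \<open>v < n\<close> by (auto simp: almost_complete_partition_def)
  ultimately show ?thesis by simp
qed

text \<open>The part of \<open>v\<close> is uncoloured, hence has no vertex before \<open>v\<close>;
  all its vertices except \<open>v\<close> are later non-neighbours. So a sample that is too small
  proves a clique.\<close>

lemma later_nonneighbours_card:
  assumes part: "almost_complete_partition n l k G c" and "tracks c C col" "v < n" "C v = 0"
    and coloured: "\<And>w. w < v \<Longrightarrow> C w \<noteq> 0"
  shows "2 * k + 1 \<le> card (later_nonneighbours v)"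
proof -
  have "2 * k + 2 \<le> card {u. u < n \<and> c u = c v}"
    using part \<open>v < n\<close> by (simp add: almost_complete_partition_def)
  also have "\<dots> \<le> card (insert v (later_nonneighbours v))"
  proof (rule card_mono)
    show "finite (insert v (later_nonneighbours v))" by (simp add: later_nonneighbours_def)
    show "{u. u < n \<and> c u = c v} \<subseteq> insert v (later_nonneighbours v)"
    proof
      fix u assume u: "u \<in> {u. u < n \<and> c u = c v}"
      then have "\<not> u < v" using tracks_new[OF assms(2-4)] coloured by auto
      moreover have "{v, u} \<notin> edges G"
        using u part multipartite_edge_iff[of v u n c] by (auto simp: almost_complete_partition_def)
      ultimately show "u \<in> insert v (later_nonneighbours v)"
        using u by (auto simp: later_nonneighbours_def)
    qed
  qed
  finally show ?thesis by (simp add: later_nonneighbours_def)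
qed

text \<open>The vote selects exactly the part of \<open>v\<close>, which was uncoloured, and by
  \<open>le\<close> the colour \<open>Suc col\<close> is fresh. So exactly one part joins the
  coloured ones.\<close>

lemma tracks_recolour:
  assumes part: "almost_complete_partition n l k G c" and tr: "tracks c C col" and v: "v < n" "C v = 0"
    and le: "\<And>w. w < n \<Longrightarrow> C w \<le> col"
    and inj: "inj_on S {..<2 * k + 1}" and S: "S ` {..<2 * k + 1} \<subseteq> later_nonneighbours v"
  shows "tracks c (recolour S (Suc col) n (C(v := Suc col))) (Suc col)"
proof -
  let ?C = "recolour S (Suc col) n (C(v := Suc col))"
  have C: "?C w = (if c w = c v then Suc col else C w)" if "w < n" for w
    using that sample_classifies[OF part v(1) that inj S] by (auto simp: recolour_def)
  have "{u. u < n \<and> ?C u \<noteq> 0} = {u. u < n \<and> C u \<noteq> 0} \<union> {u. u < n \<and> c u = c v}"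
    using C by auto
  then have "c ` {u. u < n \<and> ?C u \<noteq> 0} = insert (c v) (c ` {u. u < n \<and> C u \<noteq> 0})"
    using v(1) by auto
  moreover have "c v \<notin> c ` {u. u < n \<and> C u \<noteq> 0}"
    using tracks_new[OF tr v] by fastforce
  ultimately have "Suc col = card (c ` {u. u < n \<and> ?C u \<noteq> 0})"
    using tr by (simp add: tracks_def)
  moreover have "?C u = ?C w \<longleftrightarrow> c u = c w" if "u < n" "w < n" "?C u \<noteq> 0" for u w
    using that C[of u] C[of w] le[of u] le[of w] tr by (auto simp: tracks_def split: if_splits)
  ultimately show ?thesis unfolding tracks_def by blast
qed

lemma tracks_proper:
  assumes part: "almost_complete_partition n l k G c" and tr: "tracks c C col"
    and "\<And>u. u < n \<Longrightarrow> C u \<noteq> 0"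
  shows "proper_upto C n"
  unfolding proper_upto_def
proof (intro allI impI)
  fix v w assume vw: "v < n" "w < v" "{v, w} \<in> edges G"
  have "c v \<noteq> c w"
    using vw(3) part multipartite_edge_iff[of v w n c] by (auto simp: almost_complete_partition_def)
  then show "C v \<noteq> C w" using vw assms(3) tr by (auto simp: tracks_def)
qed

section \<open>The colouring loop\<close>

text \<open>The unconditional conjuncts provide what a sound \<open>Reject\<close> requires of the
  colours. \<open>tracks\<close> is claimed only for clique-free graphs, where it rules out every
  path to \<open>Accept\<close>.\<close>

definition colouring_state where
  "colouring_state c M C col v \<longleftrightarrow> encodes M C \<and> (\<forall>w<v. C w \<noteq> 0) \<and> (\<forall>w<n. C w \<le> col) \<and> col \<le> l \<and>
     (\<not> has_clique \<longrightarrow> tracks c C col)"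

text \<open>Cost of a new colour: collecting the sample, then classifying all vertices. The 7 is the
  \<open>9 + 1\<close> steps of the two blocks in between, less the 3 that every vertex is charged
  anyway.\<close>

definition stage_cost :: nat where
  "stage_cost = 4 * n + 5 * (2 * k + 1) + (6 * (2 * k + 1) + 7) * n + 7"

text \<open>Amortisation: \<open>(l - col) * stage_cost\<close> is a potential from which each new
  colour is paid, so a vertex itself is charged only 3 steps. \<open>2 \<le> T\<close> covers the
  path that accepts for lack of colours, which takes \<open>4 + 1\<close>.\<close>

lemma colour_vertex:
  assumes part: "\<not> has_clique \<Longrightarrow> almost_complete_partition n l k G cl" and v: "v < n"
    and st: "colouring_state cl M C col v" and T: "2 \<le> T"
    and cont: "\<And>x p a ae e u c M C col. colouring_state cl M C col (Suc v) \<Longrightarrow>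
      ans (at 38 col v (v * n) x p a ae e u c M) ((l - col) * stage_cost + T)"
  shows "ans (at 6 col v (v * n) x p a ae e u c M) ((l - col) * stage_cost + (3 + T))"
proof -
  have enc: "encodes M C" and col: "\<And>w. w < v \<Longrightarrow> C w \<noteq> 0" and le: "\<And>w. w < n \<Longrightarrow> C w \<le> col"
    and "col \<le> l" and tr: "\<not> has_clique \<Longrightarrow> tracks cl C col"
    using st by (auto simp: colouring_state_def)
  have Cv: "M (n * n + v) = C v" using enc v by (rule encodes_colour)
  have small: "n * n + v < n ^ 3" "C v < n ^ 3" "Suc col < n ^ 3" "n * n + n < n ^ 3" "v * n + v < n ^ 3"
    "v * n + n < n ^ 3" "0 < n ^ 3"
    by (rule lt_W, use le[OF v] \<open>col \<le> l\<close> row_le[OF v] v l12 sq_ge n_ge in linarith)+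
  consider "C v \<noteq> 0" | "C v = 0" "col = l" | "C v = 0" "col < l"
    using \<open>col \<le> l\<close> by fastforce
  then show ?thesis
  proof cases
    case 1
    have "colouring_state cl M C col (Suc v)"
      using st 1 by (auto simp: colouring_state_def less_Suc_eq)
    note next_vertex = cont[OF this]
    show ?thesis
      by (rule answers_steps[OF run6_coloured next_vertex]) (use small Cv 1 in auto)
  next
    case 2
    have has_clique using tracks_less[OF part tr v] 2 by blast
    then show ?thesis
      by (intro answers_steps[OF run6_full answers_accept]) (use small Cv 2 T in auto)
  next
    case 3
    let ?M = "M(n * n + v := Suc col)" and ?C = "C(v := Suc col)"
    let ?T = "(l - Suc col) * stage_cost + T"
    have enc': "encodes ?M ?C" using enc v by (rule encodes_upd_colour)
    have collected: "ans (at 24 (Suc col) v (v * n) x p a (v * n + n) (n * n + n + (2 * k + 1)) u c M')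
        (1 + ((6 * (2 * k + 1) + 7) * n + ?T))"
      if M': "encodes M' ?C" "listed M' S (2 * k + 1)" and inj: "inj_on S {..<2 * k + 1}"
        and S: "S ` {..<2 * k + 1} \<subseteq> later_nonneighbours v"
      for x p a u c M' S
    proof -
      let ?R = "recolour S (Suc col) n ?C"
      have next_state: "colouring_state cl M'' ?R (Suc col) (Suc v)" if "encodes M'' ?R" for M''
        unfolding colouring_state_def
      proof (intro conjI allI impI)
        show "tracks cl ?R (Suc col)" if "\<not> has_clique"
          using part[OF that] tr[OF that] v 3(1) le inj S by (rule tracks_recolour)
        show "?R w \<noteq> 0" if "w < Suc v" for w
          using that col[of w] by (auto simp: recolour_def less_Suc_eq)
        show "?R w \<le> Suc col" if "w < n" for w
          using le[OF that] by (auto simp: recolour_def)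
      qed (use that 3 in auto)
      have final: "ans (at 38 (Suc col) v (v * n) x p a ae e u c M'') ?T"
        if "encodes M'' ?R" for x p a ae e u c M''
        by (rule cont[OF next_state[OF that]])
      have "ans (at 25 (Suc col) v (v * n) x p a (v * n + n) (n * n + n + (2 * k + 1)) 0 c M')
          ((6 * (2 * k + 1) + 7) * Suc (n - 1) + ?T)"
      proof (rule classify[where S = S and C = ?C])
        have "recolour S (Suc col) 0 ?C = ?C" by (simp add: recolour_def fun_eq_iff)
        then show "encodes M' (recolour S (Suc col) 0 ?C)" using M' by simp
        show "S j < n" if "j < 2 * k + 1" for j
          using that S by (auto simp: later_nonneighbours_def)
      qed (use M' final n_ge in auto)
      then show ?thesis
        by (intro answers_steps[OF run24]) (use small n_ge in auto)
    qed
    have "ans (at 15 (Suc col) v (v * n) x p (v * n + v) (v * n + n) (n * n + n + 0) u c ?M)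
        (4 * Suc (n - Suc v) + 5 * (2 * k + 1 - 0) + (1 + ((6 * (2 * k + 1) + 7) * n + ?T)))" for x p
    \<comment> \<open>The sample is still empty (\<open>m = 0\<close>), so any function serves as
      \<open>S\<close>.\<close>
    proof (rule collect[OF v _ collected enc', where S = "\<lambda>_. 0"])
      assume few: "card (later_nonneighbours v) < 2 * k + 1"
      show has_clique
        using later_nonneighbours_card[OF part tr v 3(1) col] few by (meson leD)
    qed (use v in \<open>auto simp: listed_def later_nonneighbours_def\<close>)
    then have start: "ans (at 15 (Suc col) v (v * n) x p (v * n + v) (v * n + n) (n * n + n) u c ?M)
        (4 * Suc (n - Suc v) + 5 * (2 * k + 1) + (1 + ((6 * (2 * k + 1) + 7) * n + ?T)))" for x p
      by simp
    have "(l - col) * stage_cost = stage_cost + (l - Suc col) * stage_cost"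
      using 3(2) by (simp flip: mult_Suc add: Suc_diff_Suc)
    moreover have "4 * Suc (n - Suc v) \<le> 4 * n" using v by simp
    ultimately have cost: "9 + (4 * Suc (n - Suc v) + 5 * (2 * k + 1) + (1 + ((6 * (2 * k + 1) + 7) * n + ?T)))
        \<le> (l - col) * stage_cost + (3 + T)"
      using stage_cost_def by linarith
    show ?thesis
      by (rule answers_steps[OF run6_new start cost]) (use small Cv 3 in auto)
  qed
qed

text \<open>Each vertex costs 3 steps for its colour test and 3 for advancing. The final 3 are two
  steps that set up the check and the \<open>Reject\<close>.\<close>

lemma colour_all:
  assumes part: "\<not> has_clique \<Longrightarrow> almost_complete_partition n l k G cl"
    and "colouring_state cl M C col v" and "n = v + Suc d"
  shows "ans (at 6 col v (v * n) x p a ae e u c M)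
    ((l - col) * stage_cost + (6 * Suc d + (3 + (\<Sum>i=1..<n. 8 + 7 * i))))"
  using assms(2,3)
proof (induction d arbitrary: M C col v x p a ae e u c)
  case (0 M C col v)
  have v: "v < n" using 0 by simp
  have small: "Suc v < n ^ 3" "v * n + n < n ^ 3" "1 < n ^ 3" "n < n ^ 3"
    by (rule lt_W, use row_le[OF v] v sq_ge n_ge in linarith)+
  let ?V = "1 + (\<Sum>i=1..<n. 8 + 7 * i)"
  have verified: "ans (at 38 col v (v * n) x p a ae e u c M) ((l - col) * stage_cost + (3 + (2 + ?V)))"
    if st: "colouring_state cl M C col (Suc v)" for x p a ae e u c M C col
  proof -
    have n: "Suc v = n" using 0 by simp
    have C: "encodes M C" "\<And>w. w < n \<Longrightarrow> 0 < C w \<and> C w \<le> l" and tr: "\<not> has_clique \<Longrightarrow> tracks cl C col"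
      using st unfolding colouring_state_def n by (auto intro: le_trans)
    have "ans (at 43 col (Suc v) (1 * n) x p a ae e 1 c M) ?V" for x p a ae e c
    proof (rule verify[OF C, where d = "n - 2"])
      show "proper_upto C n" if "\<not> has_clique"
        by (rule tracks_proper[OF part[OF that] tr[OF that]]) (use C(2) in fastforce)
    qed (use n_ge in \<open>auto simp: proper_upto_def\<close>)
    then have "ans (at 43 col (Suc v) n x p a ae e 1 c M) ?V" for x p a ae e c
      by simp
    from answers_steps[OF run41 this order_refl]
    have "ans (at 41 col (Suc v) (v * n + n) x p a ae e u c M) (2 + ?V)" for x p a ae e u c
      using small by simp
    from answers_steps[OF run38_last this order_refl]
    have "ans (at 38 col v (v * n) x p a ae e u c M) (3 + (2 + ?V))"
      using small n by simp
    then show ?thesis by (rule answers_mono) simp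
  qed
  have "ans (at 6 col v (v * n) x p a ae e u c M) ((l - col) * stage_cost + (3 + (3 + (2 + ?V))))"
    by (rule colour_vertex[OF part v 0(1) _ verified]) auto
  then show ?case by (rule answers_mono) simp
next
  case (Suc d M C col v)
  then have v: "v < n" by simp
  have small: "Suc v < n ^ 3" "v * n + n < n ^ 3"
    by (rule lt_W, use row_le[OF v] v sq_ge n_ge in linarith)+
  let ?T = "6 * Suc d + (3 + (\<Sum>i=1..<n. 8 + 7 * i))"
  have more: "ans (at 38 col v (v * n) x p a ae e u c M) ((l - col) * stage_cost + (3 + ?T))"
    if st: "colouring_state cl M C col (Suc v)" for x p a ae e u c M C col
  proof -
    have "ans (at 6 col (Suc v) (Suc v * n) x p a ae e u c M) ((l - col) * stage_cost + ?T)"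
      using st by (rule Suc.IH) (use Suc.prems(2) in simp)
    then have "ans (at 6 col (Suc v) (v * n + n) x p a ae e u c M) ((l - col) * stage_cost + ?T)"
      by (simp add: add.commute)
    note tail = this
    show ?thesis
      by (rule answers_steps[OF run38_more tail]) (use small Suc.prems(2) in auto)
  qed
  have "ans (at 6 col v (v * n) x p a ae e u c M) ((l - col) * stage_cost + (3 + (3 + ?T)))"
    by (rule colour_vertex[OF part v Suc.prems(1) _ more]) auto
  then show ?case by (rule answers_mono) simp
qed

section \<open>Total running time\<close>

lemma two_sum_row_costs: "2 * (\<Sum>i=1..<Suc m. 8 + 7 * i) = 16 * m + 7 * (m * Suc m)"
  by (induction m) auto

text \<open>The check contributes about \<open>7/2\<close> times \<open>n * n\<close>, the term
  \<open>17 * (l * n)\<close> at most \<open>17/12\<close> and \<open>12 * (k * l * n)\<close> at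
  most \<open>12/30\<close>: together less than \<open>5.32\<close>, while \<open>l + 4\<close> is
  at least 6. The remaining linear terms are below \<open>12 * n\<close> and fit because
  \<open>n\<close> is at least 24.\<close>

lemma total_cost:
  "6 + (l * stage_cost + (6 * n + (3 + (\<Sum>i=1..<n. 8 + 7 * i)))) \<le> (l + 4) * n ^ 2"
proof -
  obtain m where m: "n = Suc m" using n_ge by (cases n) auto
  have sum: "2 * (\<Sum>i=1..<n. 8 + 7 * i) + 16 + 7 * n = 16 * n + 7 * (n * n)"
    using two_sum_row_costs[of m] by (simp add: m)
  have ln: "12 * (l * n) \<le> n * n" using mult_le_mono1[OF l12, of n] by (simp add: mult.assoc)
  have kln: "30 * (k * l * n) \<le> n * n" using mult_le_mono1[OF k_small, of n] by (simp add: ac_simps)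
  have kl: "30 * (k * l) \<le> n" using k_small by (simp add: mult.assoc)
  have nn: "2 * (n * n) \<le> l * (n * n)" using l_ge by simp
  have stages: "l * stage_cost = 12 * l + 17 * (l * n) + 10 * (k * l) + 12 * (k * l * n)"
    by (simp add: stage_cost_def algebra_simps)
  have budget: "(l + 4) * n ^ 2 = l * (n * n) + 4 * (n * n)"
    by (simp add: power2_eq_square algebra_simps)
  show ?thesis
    unfolding stages budget using sum ln kln kl nn l12 n_ge sq_ge by linarith
qed

lemma decides: "ans (init_state n l k G) ((l + 4) * n ^ 2)"
proof -
  \<comment> \<open>If a clique exists, \<open>cl\<close> is arbitrary, which lets a single run
    argument cover both cases.\<close>
  obtain cl where cl: "\<not> has_clique \<Longrightarrow> almost_complete_partition n l k G cl"
    using clique_free_imp_partition[OF inst _ l12 k_small] by blast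
  have "colouring_state cl (adj_matrix n G) (\<lambda>_. 0) 0 0"
    by (auto simp: colouring_state_def encodes_def adj_matrix_def tracks_def)
  from colour_all[OF cl this, of "n - 1"]
  have start: "ans (at 6 0 0 0 0 0 0 0 0 0 0 (adj_matrix n G))
      (l * stage_cost + (6 * n + (3 + (\<Sum>i=1..<n. 8 + 7 * i))))"
    using n_ge by simp
  have small: "n * n + n + 2 * k + 1 < n ^ 3"
    by (rule lt_W) (use k60 sq_ge n_ge in linarith)
  show ?thesis
    unfolding init_state_def init_regs_register_file
    by (rule answers_steps[OF run_init[OF small] start total_cost])
qed

end

theorem theorem1p7:
  shows "\<exists>(P :: program) (c :: nat). \<forall>(n :: nat) (l :: nat) (k :: nat).
    n \<ge> l \<longrightarrow> l \<ge> 2 \<longrightarrow> max (6 * l ^ 2) (30 * k * l) \<le> n \<longrightarrow>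
    solves_clique_embed_avg P (n ^ c) n l k ((l + 4) * n ^ 2)"
proof (intro exI allI impI)
  fix n l k :: nat
  assume *: "l \<ge> 2" "max (6 * l ^ 2) (30 * k * l) \<le> n"
  show "solves_clique_embed_avg clique_program (n ^ 3) n l k ((l + 4) * n ^ 2)"
    unfolding solves_clique_embed_avg_def
  proof (intro allI impI)
    fix G assume "embed_avg_instance (complete_graph (l + 1)) n k G"
    then interpret embed_run n l k G
      using * by unfold_locales auto
    show "answers_within clique_program (n ^ 3) (init_state n l k G) ((l + 4) * n ^ 2)
        (contains_copy G (complete_graph (l + 1)))"
      by (rule decides)
  qed
qed

end
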